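(* Let $\Omega\subset\mathbb{R}^2$ be a bounded region whose boundary $\partial\Omega$ is the union of a finite number of disjoint simple Lipschitz loops. Let $\mathbf{v}\in L^1_{loc}(\Omega;\mathbb{R}^2)$ (respectively $\mathbf{v}\in L^1(\Omega;\mathbb{R}^2)$) with $\operatorname{div}\mathbf{v},\operatorname{curl}\mathbf{v}\in L^p(\Omega)$ for some $p>1$. Then there are $\varphi_0,\psi_0\in H^1_0(\Omega)$ and a harmonic field $\mathbf{h}\in L^1_{loc}(\Omega;\mathbb{R}^2)$ (respectively $\mathbf{h}\in L^1(\Omega;\mathbb{R}^2)$) such that $$\mathbf{v}=\nabla^\perp\psi_0-\nabla\varphi_0+\mathbf{h}\quad\text{on }\Omega.$$
   Context: A region is a non-empty connected open subset of $\mathbb{R}^2$. A simple Lipschitz loop is a closed, non-self-intersecting curve with at least two distinct points and a uniformly Lipschitz parametrization. $\nabla\varphi=(D_1\varphi,D_2\varphi)$, $\nabla^\perp\psi=(D_2\psi,-D_1\psi)$. For $\mathbf{v}\in L^1_{loc}(\Omega;\mathbb{R}^2)$, $\operatorname{div}\mathbf{v}=\rho\in L^1_{loc}(\Omega)$ means $\int_\Omega\nabla\varphi\cdot\mathbf{v}\,d^2x=-\int_\Omega\rho\varphi\,d^2x$ for all $\varphi\in C^1_c(\Omega)$, and $\operatorname{curl}\mathbf{v}=\omega\in L^1_{loc}(\Omega)$ means $\int_\Omega\nabla^\perp\psi\cdot\mathbf{v}\,d^2x=\int_\Omega\omega\psi\,d^2x$ for all $\psi\in C^1_c(\Omega)$.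 A field is harmonic if its div and curl are both zero. *)

theory Defs
  imports "HOL-Analysis.Analysis"
begin

definition region :: "(real^2) set \<Rightarrow> bool" where
  "region \<Omega> \<longleftrightarrow> open \<Omega> \<and> connected \<Omega> \<and> \<Omega> \<noteq> {}"

text \<open>A simple path is injective on \<open>{0..<1}\<close>, hence non-constant, so the requirement that a loop
  has at least two distinct points is automatic.\<close>

definition simple_lipschitz_loop :: "(real^2) set \<Rightarrow> bool" where
  "simple_lipschitz_loop C \<longleftrightarrow>
     (\<exists>g L. simple_path g \<and> pathfinish g = pathstart g \<and> L-lipschitz_on {0..1} g
          \<and> path_image g = C)"

definition lipschitz_loop_boundary :: "(real^2) set \<Rightarrow> bool" where
  "lipschitz_loop_boundary \<Omega> \<longleftrightarrow>
     (\<exists>\<C>. finite \<C> \<and> (\<forall>C\<in>\<C>. simple_lipschitz_loop C) \<and> pairwise disjnt \<C>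
          \<and> frontier \<Omega> = \<Union>\<C>)"

text \<open>Elements of the function spaces below are total functions on the plane, of which only the
  values on \<open>\<Omega>\<close> matter; functions are not identified when they agree almost everywhere.\<close>

definition L1 :: "(real^2) set \<Rightarrow> (real^2 \<Rightarrow> 'b::euclidean_space) set" where
  "L1 \<Omega> = {f. set_integrable lebesgue \<Omega> f}"

definition L1_loc :: "(real^2) set \<Rightarrow> (real^2 \<Rightarrow> 'b::euclidean_space) set" where
  "L1_loc \<Omega> = {f. \<forall>K. compact K \<and> K \<subseteq> \<Omega> \<longrightarrow> set_integrable lebesgue K f}"

definition Lp :: "real \<Rightarrow> (real^2) set \<Rightarrow> (real^2 \<Rightarrow> 'b::euclidean_space) set" where
  "Lp p \<Omega> = {f. set_borel_measurable lebesgue \<Omega> f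
                 \<and> set_integrable lebesgue \<Omega> (\<lambda>x. norm (f x) powr p)}"

definition grad :: "(real^2 \<Rightarrow> real) \<Rightarrow> real^2 \<Rightarrow> real^2" where
  "grad \<phi> x = (\<chi> i. frechet_derivative \<phi> (at x) (axis i 1))"

text \<open>The rotation taking \<open>\<nabla>\<psi> = (D\<^sub>1\<psi>, D\<^sub>2\<psi>)\<close> to \<open>\<nabla>\<^sup>\<bottom>\<psi> = (D\<^sub>2\<psi>, -D\<^sub>1\<psi>)\<close>.\<close>

definition perp :: "real^2 \<Rightarrow> real^2" where
  "perp a = vector [a $ 2, - (a $ 1)]"

text \<open>\<open>C\<^sup>1\<close> functions with compact support in \<open>\<Omega>\<close>, extended by zero to the whole plane.\<close>

definition C1_c :: "(real^2) set \<Rightarrow> (real^2 \<Rightarrow> real) set" where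
  "C1_c \<Omega> = {\<phi>. (\<forall>x. \<phi> differentiable (at x)) \<and> continuous_on UNIV (grad \<phi>)
                 \<and> compact (closure {x. \<phi> x \<noteq> 0}) \<and> closure {x. \<phi> x \<noteq> 0} \<subseteq> \<Omega>}"

definition has_weak_div ::
    "(real^2) set \<Rightarrow> (real^2 \<Rightarrow> real^2) \<Rightarrow> (real^2 \<Rightarrow> real) \<Rightarrow> bool" where
  "has_weak_div \<Omega> v \<rho> \<longleftrightarrow> v \<in> L1_loc \<Omega> \<and> \<rho> \<in> L1_loc \<Omega> \<and>
     (\<forall>\<phi>\<in>C1_c \<Omega>. (LINT x:\<Omega>|lebesgue. grad \<phi> x \<bullet> v x) = - (LINT x:\<Omega>|lebesgue. \<rho> x * \<phi> x))"

definition has_weak_curl ::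
    "(real^2) set \<Rightarrow> (real^2 \<Rightarrow> real^2) \<Rightarrow> (real^2 \<Rightarrow> real) \<Rightarrow> bool" where
  "has_weak_curl \<Omega> v \<omega> \<longleftrightarrow> v \<in> L1_loc \<Omega> \<and> \<omega> \<in> L1_loc \<Omega> \<and>
     (\<forall>\<psi>\<in>C1_c \<Omega>. (LINT x:\<Omega>|lebesgue. perp (grad \<psi> x) \<bullet> v x) = (LINT x:\<Omega>|lebesgue. \<omega> x * \<psi> x))"

definition harmonic_field :: "(real^2) set \<Rightarrow> (real^2 \<Rightarrow> real^2) \<Rightarrow> bool" where
  "harmonic_field \<Omega> h \<longleftrightarrow> has_weak_div \<Omega> h (\<lambda>_. 0) \<and> has_weak_curl \<Omega> h (\<lambda>_. 0)"

definition has_weak_gradient ::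
    "(real^2) set \<Rightarrow> (real^2 \<Rightarrow> real) \<Rightarrow> (real^2 \<Rightarrow> real^2) \<Rightarrow> bool" where
  "has_weak_gradient \<Omega> u G \<longleftrightarrow> u \<in> L1_loc \<Omega> \<and> G \<in> L1_loc \<Omega> \<and>
     (\<forall>\<phi>\<in>C1_c \<Omega>. (LINT x:\<Omega>|lebesgue. u x *\<^sub>R grad \<phi> x) = - (LINT x:\<Omega>|lebesgue. \<phi> x *\<^sub>R G x))"

text \<open>\<open>H\<^sup>1\<^sub>0(\<Omega>)\<close> is the closure of \<open>C\<^sup>1\<^sub>c(\<Omega>)\<close> in \<open>H\<^sup>1(\<Omega>)\<close>; the convergence below is that of the
  \<open>H\<^sup>1\<close>-distance between \<open>\<phi> n\<close> and \<open>u\<close> to zero.\<close>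

definition H1_0 :: "(real^2) set \<Rightarrow> (real^2 \<Rightarrow> real) set" where
  "H1_0 \<Omega> = {u. \<exists>G. u \<in> Lp 2 \<Omega> \<and> G \<in> Lp 2 \<Omega> \<and> has_weak_gradient \<Omega> u G \<and>
     (\<exists>\<phi>. (\<forall>n. \<phi> n \<in> C1_c \<Omega>) \<and>
       (\<lambda>n. sqrt (LINT x:\<Omega>|lebesgue. (\<phi> n x - u x)\<^sup>2 + (norm (grad (\<phi> n) x - G x))\<^sup>2))
         \<longlonglongrightarrow> 0)}"

text \<open>\<open>v = \<nabla>\<^sup>\<bottom>\<psi> - \<nabla>\<phi> + h\<close> on \<open>\<Omega>\<close>, as an identity of fields in \<open>L\<^sup>1\<^sub>l\<^sub>o\<^sub>c\<close>, that is, almost everywhere.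
  Weak gradients are unique up to null sets, so the choice of \<open>F\<close> and \<open>G\<close> is immaterial.\<close>

definition has_decomposition ::
    "(real^2) set \<Rightarrow> (real^2 \<Rightarrow> real^2) \<Rightarrow> (real^2 \<Rightarrow> real) \<Rightarrow> (real^2 \<Rightarrow> real) \<Rightarrow> (real^2 \<Rightarrow> real^2) \<Rightarrow> bool"
  where
  "has_decomposition \<Omega> v \<psi> \<phi> h \<longleftrightarrow>
     (\<exists>F G. has_weak_gradient \<Omega> \<psi> F \<and> has_weak_gradient \<Omega> \<phi> G \<and>
        (AE x in lebesgue. x \<in> \<Omega> \<longrightarrow> v x = perp (F x) - G x + h x))"

end

theory Submission
  imports Defs
begin

text \<open>
  Take \<open>\<phi>\<^sub>0\<close> and \<open>\<psi>\<^sub>0\<close> to be the weak solutions in \<open>H\<^sup>1\<^sub>0\<close> of the Poisson equations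
  \<open>-\<Delta>\<phi>\<^sub>0 = \<rho>\<close> and \<open>-\<Delta>\<psi>\<^sub>0 = \<omega>\<close>, and let \<open>h = v - \<nabla>\<^sup>\<bottom>\<psi>\<^sub>0 + \<nabla>\<phi>\<^sub>0\<close>.  The divergence of \<open>h\<close>
  vanishes because \<open>\<nabla>\<phi>\<^sub>0\<close> cancels \<open>\<rho>\<close> and a rotated gradient is divergence free; the curl vanishes
  because \<open>\<nabla>\<^sup>\<bottom>\<psi>\<^sub>0\<close> cancels \<open>\<omega>\<close> and a gradient is curl free.  Both gradients are square integrable,
  hence integrable on the bounded set \<open>\<Omega>\<close>, so \<open>h\<close> is integrable wherever \<open>v\<close> is.

  Solving the Poisson equation (\<open>weak_Poisson\<close>) means representing the functional
  \<open>\<eta> \<mapsto> \<integral> \<rho> \<eta>\<close> by the Dirichlet inner product.  The functional is bounded for every \<open>p > 1\<close> because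
  in two dimensions the Dirichlet energy of functions supported in a bounded set controls every
  \<open>L\<^sup>q\<close> norm with \<open>q\<close> finite.
  For even \<open>q\<close> this follows by induction from the inequality \<open>\<integral> u\<^sup>2 \<le> (\<integral> |\<nabla>u|)\<^sup>2\<close>
  (\<open>Gagliardo_Nirenberg\<close>, \<open>Sobolev_even_power\<close>), applied to powers of \<open>u\<close>; Young's inequality then
  gives the bound (\<open>Lp_bounded_functional\<close>).  The representing element is produced by hand: a
  minimizing sequence of test functions is Cauchy (\<open>approximate_Riesz_representation\<close>) and converges
  in \<open>L\<^sup>2\<close> together with its gradients (\<open>rapidly_Cauchy_L2_limit\<close>).

  Since test functions are only of class \<open>C\<^sup>1\<close>, the orthogonality of gradients and rotated gradients
  cannot be read off from the symmetry of second derivatives.  It is proved with difference quotients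
  and translation invariance of Lebesgue measure (\<open>integral_grad_grad_commute\<close>), and it passes to
  the limit because the solutions are limits of test functions.
\<close>

section \<open>Compactly supported functions of class \<open>C\<^sup>1\<close>\<close>

lemma grad_eqI:
  assumes "(\<phi> has_derivative (\<lambda>h. w \<bullet> h)) (at x)"
  shows "grad \<phi> x = w"
  using frechet_derivative_at[OF assms, symmetric]
  by (simp add: grad_def vec_eq_iff inner_axis)

lemma has_derivative_grad:
  assumes "\<phi> differentiable (at x)"
  shows "(\<phi> has_derivative (\<lambda>h. grad \<phi> x \<bullet> h)) (at x)"
proof -
  let ?D = "frechet_derivative \<phi> (at x)"
  have D: "(\<phi> has_derivative ?D) (at x)"
    using assms frechet_derivative_works by blast
  have lin: "linear ?D"
    using D has_derivative_linear by blast
  have "?D h = grad \<phi> x \<bullet> h" for h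
  proof -
    have "?D h = ?D (\<Sum>i\<in>UNIV. (h $ i) *\<^sub>R axis i 1)"
      by (simp add: basis_expansion scalar_mult_eq_scaleR [symmetric])
    also have "\<dots> = (\<Sum>i\<in>UNIV. (h $ i) * ?D (axis i 1))"
      by (simp add: linear_sum[OF lin] linear_cmul[OF lin])
    finally show ?thesis
      by (simp add: grad_def inner_vec_def mult.commute)
  qed
  then have "?D = (\<lambda>h. grad \<phi> x \<bullet> h)" by blast
  with D show ?thesis by simp
qed

text \<open>The gradient vanishes outside the support because the complement of the support is open.  The
  compact set of the last claim serves below as the common domain of all integrands.\<close>

lemma C1_cD:
  assumes "\<phi> \<in> C1_c \<Omega>"
  shows "(\<phi> has_derivative (\<lambda>h. grad \<phi> x \<bullet> h)) (at x)"
    and "continuous_on UNIV \<phi>" and "continuous_on UNIV (grad \<phi>)"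
    and "\<exists>K. compact K \<and> K \<subseteq> \<Omega> \<and> (\<forall>x. x \<notin> K \<longrightarrow> \<phi> x = 0 \<and> grad \<phi> x = 0)"
proof -
  have diff: "\<phi> differentiable (at x)" for x
    using assms by (simp add: C1_c_def)
  show D: "(\<phi> has_derivative (\<lambda>h. grad \<phi> x \<bullet> h)) (at x)" for x
    using has_derivative_grad diff by blast
  show "continuous_on UNIV \<phi>"
    using diff by (simp add: continuous_at_imp_continuous_on differentiable_imp_continuous_within)
  show "continuous_on UNIV (grad \<phi>)"
    using assms by (simp add: C1_c_def)
  let ?K = "closure {x. \<phi> x \<noteq> 0}"
  have van: "\<phi> x = 0 \<and> grad \<phi> x = 0" if "x \<notin> ?K" for x
  proof
    have *: "y \<notin> ?K \<Longrightarrow> \<phi> y = 0" for y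
      using closure_subset[of "{x. \<phi> x \<noteq> 0}"] by auto
    then show "\<phi> x = 0" using that by blast
    have "(\<phi> has_derivative (\<lambda>h. 0)) (at x)"
    proof (rule has_derivative_transform_within_open[OF has_derivative_const])
      show "open (- ?K)" by (rule open_Compl[OF closed_closure])
      show "x \<in> - ?K" using that by simp
      show "0 = \<phi> y" if "y \<in> - ?K" for y using *[OF ComplD[OF that]] by (rule sym)
    qed
    then show "grad \<phi> x = 0" by (intro grad_eqI) simp
  qed
  have "compact ?K \<and> ?K \<subseteq> \<Omega>"
    using assms by (simp add: C1_c_def)
  with van show "\<exists>K. compact K \<and> K \<subseteq> \<Omega> \<and> (\<forall>x. x \<notin> K \<longrightarrow> \<phi> x = 0 \<and> grad \<phi> x = 0)"
    by (intro exI[of _ ?K] conjI allI impI) blast+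
qed

lemma C1_cI:
  assumes D: "\<And>x. (\<phi> has_derivative (\<lambda>h. w x \<bullet> h)) (at x)" and "continuous_on UNIV w"
    and "compact K" "K \<subseteq> \<Omega>" "\<And>x. x \<notin> K \<Longrightarrow> \<phi> x = 0"
  shows "\<phi> \<in> C1_c \<Omega>" and "grad \<phi> = w"
proof -
  show g: "grad \<phi> = w" using D grad_eqI by blast
  have "{x. \<phi> x \<noteq> 0} \<subseteq> K" using assms(5) by blast
  then have "closure {x. \<phi> x \<noteq> 0} \<subseteq> K"
    using \<open>compact K\<close> by (simp add: closure_minimal compact_imp_closed)
  moreover from this have "compact (closure {x. \<phi> x \<noteq> 0})"
    using \<open>compact K\<close> by (meson bounded_subset closed_closure compact_eq_bounded_closed)
  ultimately show "\<phi> \<in> C1_c \<Omega>"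
    using assms g by (auto simp: C1_c_def differentiable_def)
qed

lemma C1_c_mono: "\<Omega> \<subseteq> \<Omega>' \<Longrightarrow> C1_c \<Omega> \<subseteq> C1_c \<Omega>'"
  by (auto simp: C1_c_def)

lemma C1_c_zero: "(\<lambda>x. 0) \<in> C1_c \<Omega>" "grad (\<lambda>x. 0) = (\<lambda>x. 0)"
  by (rule C1_cI[of "\<lambda>x. 0" "\<lambda>x. 0" "{}"]; simp)+

lemma C1_c_lincomb:
  assumes "\<phi> \<in> C1_c \<Omega>" "\<psi> \<in> C1_c \<Omega>"
  shows "(\<lambda>x. \<phi> x + c * \<psi> x) \<in> C1_c \<Omega>"
    and "grad (\<lambda>x. \<phi> x + c * \<psi> x) = (\<lambda>x. grad \<phi> x + c *\<^sub>R grad \<psi> x)"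
proof -
  obtain K L where K: "compact K" "K \<subseteq> \<Omega>" "\<forall>x. x \<notin> K \<longrightarrow> \<phi> x = 0 \<and> grad \<phi> x = 0"
    and L: "compact L" "L \<subseteq> \<Omega>" "\<forall>x. x \<notin> L \<longrightarrow> \<psi> x = 0 \<and> grad \<psi> x = 0"
    using C1_cD(4)[OF assms(1)] C1_cD(4)[OF assms(2)] by blast
  have D: "((\<lambda>x. \<phi> x + c * \<psi> x) has_derivative (\<lambda>h. (grad \<phi> x + c *\<^sub>R grad \<psi> x) \<bullet> h)) (at x)" for x
    by (auto intro!: derivative_eq_intros C1_cD(1)[OF assms(1)] C1_cD(1)[OF assms(2)]
             simp: inner_add_left)
  have C: "continuous_on UNIV (\<lambda>x. grad \<phi> x + c *\<^sub>R grad \<psi> x)"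
    by (intro continuous_intros C1_cD(3)[OF assms(1)] C1_cD(3)[OF assms(2)])
  have KL: "compact (K \<union> L)" "K \<union> L \<subseteq> \<Omega>"
    using K L by auto
  have Z: "\<phi> x + c * \<psi> x = 0" if "x \<notin> K \<union> L" for x
    using that K(3) L(3) by simp
  show "(\<lambda>x. \<phi> x + c * \<psi> x) \<in> C1_c \<Omega>"
    "grad (\<lambda>x. \<phi> x + c * \<psi> x) = (\<lambda>x. grad \<phi> x + c *\<^sub>R grad \<psi> x)"
    by (rule C1_cI[OF D C KL Z], assumption?)+
qed

lemma C1_c_mult:
  assumes "\<phi> \<in> C1_c \<Omega>" "\<psi> \<in> C1_c \<Omega>"
  shows "(\<lambda>x. \<phi> x * \<psi> x) \<in> C1_c \<Omega>"
    and "grad (\<lambda>x. \<phi> x * \<psi> x) = (\<lambda>x. \<phi> x *\<^sub>R grad \<psi> x + \<psi> x *\<^sub>R grad \<phi> x)"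
proof -
  obtain K where K: "compact K" "K \<subseteq> \<Omega>" "\<forall>x. x \<notin> K \<longrightarrow> \<phi> x = 0 \<and> grad \<phi> x = 0"
    using C1_cD(4)[OF assms(1)] by blast
  have D: "((\<lambda>x. \<phi> x * \<psi> x) has_derivative (\<lambda>h. (\<phi> x *\<^sub>R grad \<psi> x + \<psi> x *\<^sub>R grad \<phi> x) \<bullet> h)) (at x)" for x
    by (auto intro!: derivative_eq_intros C1_cD(1)[OF assms(1)] C1_cD(1)[OF assms(2)]
             simp: inner_add_left algebra_simps)
  have C: "continuous_on UNIV (\<lambda>x. \<phi> x *\<^sub>R grad \<psi> x + \<psi> x *\<^sub>R grad \<phi> x)"
    by (intro continuous_intros C1_cD(2,3)[OF assms(1)] C1_cD(2,3)[OF assms(2)])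
  have Z: "\<phi> x * \<psi> x = 0" if "x \<notin> K" for x
    using that K(3) by simp
  show "(\<lambda>x. \<phi> x * \<psi> x) \<in> C1_c \<Omega>"
    "grad (\<lambda>x. \<phi> x * \<psi> x) = (\<lambda>x. \<phi> x *\<^sub>R grad \<psi> x + \<psi> x *\<^sub>R grad \<phi> x)"
    by (rule C1_cI[OF D C K(1,2) Z], assumption?)+
qed

lemma C1_c_power:
  assumes "\<phi> \<in> C1_c \<Omega>"
  shows "(\<lambda>x. \<phi> x ^ Suc n) \<in> C1_c \<Omega>
       \<and> grad (\<lambda>x. \<phi> x ^ Suc n) = (\<lambda>x. (real (Suc n) * \<phi> x ^ n) *\<^sub>R grad \<phi> x)"
proof (induction n)
  case 0
  then show ?case using assms by simp
next
  case (Suc n)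
  have "grad (\<lambda>x. \<phi> x ^ Suc (Suc n))
      = (\<lambda>x. \<phi> x *\<^sub>R ((real (Suc n) * \<phi> x ^ n) *\<^sub>R grad \<phi> x) + \<phi> x ^ Suc n *\<^sub>R grad \<phi> x)"
    using C1_c_mult(2)[OF assms conjunct1[OF Suc]] conjunct2[OF Suc] by simp
  also have "\<dots> = (\<lambda>x. (real (Suc (Suc n)) * \<phi> x ^ Suc n) *\<^sub>R grad \<phi> x)"
  proof (rule ext)
    fix x
    have "\<phi> x *\<^sub>R ((real (Suc n) * \<phi> x ^ n) *\<^sub>R grad \<phi> x) + \<phi> x ^ Suc n *\<^sub>R grad \<phi> x
        = (\<phi> x * (real (Suc n) * \<phi> x ^ n) + \<phi> x ^ Suc n) *\<^sub>R grad \<phi> x"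
      by (simp only: scaleR_add_left scaleR_scaleR)
    also have "\<phi> x * (real (Suc n) * \<phi> x ^ n) + \<phi> x ^ Suc n = real (Suc (Suc n)) * \<phi> x ^ Suc n"
      by (simp add: algebra_simps)
    finally show "\<phi> x *\<^sub>R ((real (Suc n) * \<phi> x ^ n) *\<^sub>R grad \<phi> x) + \<phi> x ^ Suc n *\<^sub>R grad \<phi> x
        = (real (Suc (Suc n)) * \<phi> x ^ Suc n) *\<^sub>R grad \<phi> x" .
  qed
  finally show ?case
    using C1_c_mult(1)[OF assms conjunct1[OF Suc]] by simp
qed

lemma C1_c_translate:
  assumes "\<phi> \<in> C1_c UNIV"
  shows "(\<lambda>x. \<phi> (x + a)) \<in> C1_c UNIV" and "grad (\<lambda>x. \<phi> (x + a)) = (\<lambda>x. grad \<phi> (x + a))"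
proof -
  obtain K where K: "compact K" "\<forall>x. x \<notin> K \<longrightarrow> \<phi> x = 0 \<and> grad \<phi> x = 0"
    using C1_cD(4)[OF assms] by blast
  have D: "((\<lambda>x. \<phi> (x + a)) has_derivative (\<lambda>h. grad \<phi> (x + a) \<bullet> h)) (at x)" for x
  proof -
    have "((\<lambda>x. x + a) has_derivative (\<lambda>h. h)) (at x)"
      by (auto intro!: derivative_eq_intros)
    then show ?thesis by (rule has_derivative_compose[OF _ C1_cD(1)[OF assms]])
  qed
  have C: "continuous_on UNIV (\<lambda>x. grad \<phi> (x + a))"
    by (rule continuous_on_compose2[OF C1_cD(3)[OF assms]]) (auto intro!: continuous_intros)
  have K': "compact ((\<lambda>x. x - a) ` K)"
    using K(1) by (intro compact_continuous_image continuous_intros)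
  have "\<phi> (x + a) = 0" if "x \<notin> (\<lambda>x. x - a) ` K" for x
  proof -
    have "x + a \<notin> K" using that by (metis add_diff_cancel image_eqI)
    then show ?thesis using K by blast
  qed
  then have Z: "\<And>x. x \<notin> (\<lambda>x. x - a) ` K \<Longrightarrow> \<phi> (x + a) = 0" .
  show "(\<lambda>x. \<phi> (x + a)) \<in> C1_c UNIV" "grad (\<lambda>x. \<phi> (x + a)) = (\<lambda>x. grad \<phi> (x + a))"
    by (rule C1_cI[OF D C K' subset_UNIV Z], assumption?)+
qed

lemma C1_c_bounded:
  assumes "\<phi> \<in> C1_c \<Omega>"
  shows "\<exists>B. \<forall>x. \<bar>\<phi> x\<bar> \<le> B \<and> norm (grad \<phi> x) \<le> B"
proof -
  obtain K where K: "compact K" "\<forall>x. x \<notin> K \<longrightarrow> \<phi> x = 0 \<and> grad \<phi> x = 0"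
    using C1_cD(4)[OF assms] by blast
  have "bounded ((\<lambda>x. (\<phi> x, grad \<phi> x)) ` K)"
    using K(1) C1_cD(2,3)[OF assms]
    by (intro compact_imp_bounded compact_continuous_image continuous_intros)
       (auto intro: continuous_on_subset)
  then obtain B where B: "\<And>x. x \<in> K \<Longrightarrow> norm (\<phi> x, grad \<phi> x) \<le> B"
    unfolding bounded_iff by blast
  have "\<bar>\<phi> x\<bar> \<le> \<bar>B\<bar> \<and> norm (grad \<phi> x) \<le> \<bar>B\<bar>" for x
  proof (cases "x \<in> K")
    case True
    have "\<bar>\<phi> x\<bar> \<le> norm (\<phi> x, grad \<phi> x)" "norm (grad \<phi> x) \<le> norm (\<phi> x, grad \<phi> x)"
      using norm_fst_le[of "\<phi> x" "grad \<phi> x"] norm_snd_le[of "grad \<phi> x" "\<phi> x"] by auto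
    then show ?thesis using B[OF True] by linarith
  qed (use K in auto)
  then show ?thesis by (intro exI[of _ "\<bar>B\<bar>"] allI)
qed

lemma C1_c_measurable:
  assumes "\<phi> \<in> C1_c \<Omega>"
  shows "\<phi> \<in> borel_measurable borel" and "grad \<phi> \<in> borel_measurable borel"
  using C1_cD(2,3)[OF assms] by (simp_all add: borel_measurable_continuous_onI)

lemma integrable_continuous_compact_support:
  fixes f :: "'a::euclidean_space \<Rightarrow> 'b::{banach, second_countable_topology}"
  assumes "continuous_on UNIV f" "compact K" "\<And>x. x \<notin> K \<Longrightarrow> f x = 0"
  shows "integrable lborel f"
proof -
  have "(\<lambda>x. indicator K x *\<^sub>R f x) = f"
    using assms(3) by (auto simp: fun_eq_iff indicator_def)
  then show ?thesis
    using borel_integrable_compact[OF assms(2), of f] assms(1) continuous_on_subset by fastforce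
qed

section \<open>Integration by parts\<close>

lemma integral_translate:
  fixes f :: "'a::euclidean_space \<Rightarrow> 'b::{banach, second_countable_topology}"
  assumes "f \<in> borel_measurable borel"
  shows "(LINT x|lborel. f (x + a)) = (LINT x|lborel. f x)"
proof -
  have "(LINT x|lborel. f x) = (LINT x|distr lborel borel ((+) a). f x)"
    by (simp add: lborel_distr_plus)
  also have "\<dots> = (LINT x|lborel. f (a + x))"
    using assms by (subst integral_distr) auto
  finally show ?thesis by (simp add: add.commute)
qed

text \<open>The gradient is a dominated limit of difference quotients, because the latter are bounded by
  the mean value theorem and vanish outside one fixed ball.  This makes translation invariance of
  Lebesgue measure do the work of integration by parts.\<close>

lemma difference_quotients_tendsto:
  fixes w :: "real^2 \<Rightarrow> real"
  assumes \<phi>: "\<phi> \<in> C1_c UNIV" and w: "continuous_on UNIV w"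
  shows "(\<lambda>n. LINT x|lborel. ((\<phi> (x + inverse (real (Suc n)) *\<^sub>R a) - \<phi> x) * real (Suc n)) * w x)
           \<longlonglongrightarrow> (LINT x|lborel. (grad \<phi> x \<bullet> a) * w x)"
proof -
  define t where "t n = inverse (real (Suc n))" for n
  have t: "0 < t n" "t n \<le> 1" "t n * real (Suc n) = 1" for n
    by (auto simp: t_def divide_simps)
  have t0: "t \<longlonglongrightarrow> 0"
    unfolding t_def by (rule LIMSEQ_inverse_real_of_nat)
  obtain K where K: "compact K" "\<forall>x. x \<notin> K \<longrightarrow> \<phi> x = 0 \<and> grad \<phi> x = 0"
    using C1_cD(4)[OF \<phi>] by blast
  obtain r where r: "\<And>x. x \<in> K \<Longrightarrow> norm x \<le> r"
    using compact_imp_bounded[OF K(1)] unfolding bounded_iff by blast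
  obtain B where B: "\<And>x. norm (grad \<phi> x) \<le> B"
    using C1_c_bounded[OF \<phi>] by blast
  \<comment> \<open>large enough to contain the supports of all translates by \<open>s *\<^sub>R a\<close> with \<open>0 \<le> s \<le> 1\<close>\<close>
  define S :: "(real^2) set" where "S = cball 0 (r + norm a)"
  have S: "\<phi> (x + s *\<^sub>R a) = 0" if "x \<notin> S" "0 \<le> s" "s \<le> 1" for x s
  proof -
    have "norm (s *\<^sub>R a) \<le> norm a" using that by (simp add: mult_left_le_one_le)
    then have "norm (x + s *\<^sub>R a) > r"
      using that norm_diff_ineq[of x "s *\<^sub>R a"] unfolding S_def by auto
    then show ?thesis using K r by force
  qed
  have bound: "\<bar>(\<phi> (x + t n *\<^sub>R a) - \<phi> x) * real (Suc n)\<bar> \<le> B * norm a" for x n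
  proof -
    have "norm (\<phi> (x + t n *\<^sub>R a) - \<phi> x) \<le> B * norm ((x + t n *\<^sub>R a) - x)"
    proof (rule differentiable_bound[of UNIV])
      show "(\<phi> has_derivative (\<lambda>h. grad \<phi> y \<bullet> h)) (at y within UNIV)" for y
        by (rule C1_cD(1)[OF \<phi>])
      show "onorm (\<lambda>h. grad \<phi> y \<bullet> h) \<le> B" for y
      proof (rule onorm_le)
        fix h
        have "\<bar>grad \<phi> y \<bullet> h\<bar> \<le> norm (grad \<phi> y) * norm h" by (rule Cauchy_Schwarz_ineq2)
        also have "\<dots> \<le> B * norm h" using B by (intro mult_right_mono) auto
        finally show "norm (grad \<phi> y \<bullet> h) \<le> B * norm h" by simp
      qed
    qed auto
    also have "\<dots> = B * norm a * t n" using t(1)[of n] by simp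
    finally have "\<bar>\<phi> (x + t n *\<^sub>R a) - \<phi> x\<bar> * real (Suc n) \<le> B * norm a * t n * real (Suc n)"
      by (intro mult_right_mono) auto
    also have "\<dots> = B * norm a" using t(3)[of n] by (simp only: mult.assoc mult_1_right)
    finally show ?thesis by (simp add: abs_mult)
  qed
  have "(\<lambda>n. LINT x|lborel. ((\<phi> (x + t n *\<^sub>R a) - \<phi> x) * real (Suc n)) * w x)
           \<longlonglongrightarrow> (LINT x|lborel. (grad \<phi> x \<bullet> a) * w x)"
  proof (rule integral_dominated_convergence)
    have [measurable]: "w \<in> borel_measurable borel" "\<phi> \<in> borel_measurable borel"
      "grad \<phi> \<in> borel_measurable borel"
      using w C1_c_measurable[OF \<phi>] by (simp_all add: borel_measurable_continuous_onI)
    show "(\<lambda>x. (grad \<phi> x \<bullet> a) * w x) \<in> borel_measurable lborel"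
      "(\<lambda>x. ((\<phi> (x + t n *\<^sub>R a) - \<phi> x) * real (Suc n)) * w x) \<in> borel_measurable lborel" for n
      by measurable
    show "integrable lborel (\<lambda>x. indicator S x *\<^sub>R (B * norm a * \<bar>w x\<bar>))"
      unfolding S_def using w
      by (intro borel_integrable_compact continuous_intros) (auto intro: continuous_on_subset)
    show "AE x in lborel. (\<lambda>n. (\<phi> (x + t n *\<^sub>R a) - \<phi> x) * real (Suc n) * w x)
             \<longlonglongrightarrow> (grad \<phi> x \<bullet> a) * w x"
    proof (intro AE_I2 tendsto_mult tendsto_const)
      fix x
      have line: "((\<lambda>s::real. x + s *\<^sub>R a) has_derivative (\<lambda>s. s *\<^sub>R a)) (at 0)"
        by (auto intro!: derivative_eq_intros)
      have "((\<lambda>s. \<phi> (x + s *\<^sub>R a)) has_derivative (\<lambda>s. grad \<phi> (x + 0 *\<^sub>R a) \<bullet> (s *\<^sub>R a))) (at 0)"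
        by (rule has_derivative_compose[OF line C1_cD(1)[OF \<phi>]])
      moreover have "(\<lambda>s. grad \<phi> (x + 0 *\<^sub>R a) \<bullet> (s *\<^sub>R a)) = (*) (grad \<phi> x \<bullet> a)"
        by (simp add: fun_eq_iff)
      ultimately have "((\<lambda>s. \<phi> (x + s *\<^sub>R a)) has_field_derivative (grad \<phi> x \<bullet> a)) (at 0)"
        by (simp only: has_field_derivative_def)
      then have "((\<lambda>s. (\<phi> (x + s *\<^sub>R a) - \<phi> x) / s) \<longlongrightarrow> grad \<phi> x \<bullet> a) (at 0)"
        by (simp add: has_field_derivative_iff)
      moreover have "filterlim t (at 0) sequentially"
        using t0 t(1) by (simp add: filterlim_at less_imp_neq[symmetric] order.strict_implies_not_eq)
      ultimately have "(\<lambda>n. (\<phi> (x + t n *\<^sub>R a) - \<phi> x) / t n) \<longlonglongrightarrow> grad \<phi> x \<bullet> a"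
        by (rule filterlim_compose)
      then show "(\<lambda>n. (\<phi> (x + t n *\<^sub>R a) - \<phi> x) * real (Suc n)) \<longlonglongrightarrow> grad \<phi> x \<bullet> a"
        by (simp add: t_def divide_inverse)
    qed
    show "AE x in lborel. norm ((\<phi> (x + t n *\<^sub>R a) - \<phi> x) * real (Suc n) * w x)
             \<le> indicator S x *\<^sub>R (B * norm a * \<bar>w x\<bar>)" for n
    proof (intro AE_I2)
      fix x
      show "norm ((\<phi> (x + t n *\<^sub>R a) - \<phi> x) * real (Suc n) * w x)
             \<le> indicator S x *\<^sub>R (B * norm a * \<bar>w x\<bar>)"
      proof (cases "x \<in> S")
        case True
        then show ?thesis
          using mult_right_mono[OF bound[of x n], of "\<bar>w x\<bar>"] by (simp add: abs_mult)
      next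
        case False
        then show ?thesis
          using S[of x "t n"] S[of x 0] t[of n] by simp
      qed
    qed
  qed
  then show ?thesis by (simp add: t_def)
qed

lemma integral_grad_eq_0:
  assumes "\<phi> \<in> C1_c \<Omega>"
  shows "(LINT x|lborel. grad \<phi> x \<bullet> a) = 0"
proof -
  have \<phi>: "\<phi> \<in> C1_c UNIV" using assms C1_c_mono by blast
  have int: "integrable lborel (\<lambda>x. \<phi> (x + b))" for b
  proof -
    obtain K where K: "compact K" "\<forall>x. x \<notin> K \<longrightarrow> \<phi> (x + b) = 0"
      using C1_cD(4)[OF C1_c_translate(1)[OF \<phi>, of b]] by blast
    show ?thesis
      using integrable_continuous_compact_support[OF C1_cD(2)[OF C1_c_translate(1)[OF \<phi>]] K(1)] K(2)
      by blast
  qed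
  have "(LINT x|lborel. \<phi> (x + b) - \<phi> x) = 0" for b
    using int[of b] int[of 0] integral_translate[of \<phi> b] C1_c_measurable[OF \<phi>]
    by simp
  then have "(\<lambda>n. LINT x|lborel. ((\<phi> (x + inverse (real (Suc n)) *\<^sub>R a) - \<phi> x) * real (Suc n)) * 1) \<longlonglongrightarrow> 0"
    by simp
  moreover note difference_quotients_tendsto[OF \<phi>, of "\<lambda>x. 1" a]
  ultimately show ?thesis
    using LIMSEQ_unique by fastforce
qed

lemma C1_c_parts:
  assumes "\<phi> \<in> C1_c \<Omega>" "\<psi> \<in> C1_c \<Omega>'"
  shows "(LINT x|lborel. \<phi> x * (grad \<psi> x \<bullet> a)) = - (LINT x|lborel. (grad \<phi> x \<bullet> a) * \<psi> x)"
proof -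
  have \<phi>: "\<phi> \<in> C1_c UNIV" and \<psi>: "\<psi> \<in> C1_c UNIV" using assms C1_c_mono by blast+
  obtain K where K: "compact K" "\<forall>x. x \<notin> K \<longrightarrow> \<phi> x = 0 \<and> grad \<phi> x = 0"
    using C1_cD(4)[OF \<phi>] by blast
  have int: "integrable lborel (\<lambda>x. \<phi> x * (grad \<psi> x \<bullet> a))" "integrable lborel (\<lambda>x. (grad \<phi> x \<bullet> a) * \<psi> x)"
    using C1_cD(2,3)[OF \<phi>] C1_cD(2,3)[OF \<psi>] K
    by (auto intro!: integrable_continuous_compact_support[OF _ K(1)] continuous_intros)
  have "0 = (LINT x|lborel. \<phi> x * (grad \<psi> x \<bullet> a) + (grad \<phi> x \<bullet> a) * \<psi> x)"
    using integral_grad_eq_0[OF C1_c_mult(1)[OF \<phi> \<psi>], of a]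
    by (simp add: C1_c_mult(2)[OF \<phi> \<psi>] inner_add_left mult.commute)
  also have "\<dots> = (LINT x|lborel. \<phi> x * (grad \<psi> x \<bullet> a)) + (LINT x|lborel. (grad \<phi> x \<bullet> a) * \<psi> x)"
    using int by simp
  finally show ?thesis by simp
qed

text \<open>For functions of class \<open>C\<^sup>2\<close> this is two integrations by parts and the symmetry of second
  derivatives.  With \<open>C\<^sup>1\<close> functions only, one of the two derivatives is first replaced by a
  difference quotient, which commutes with the other derivative.\<close>

lemma integral_grad_grad_commute:
  assumes "\<phi> \<in> C1_c \<Omega>" "\<psi> \<in> C1_c \<Omega>'"
  shows "(LINT x|lborel. (grad \<phi> x \<bullet> a) * (grad \<psi> x \<bullet> b)) = (LINT x|lborel. (grad \<phi> x \<bullet> b) * (grad \<psi> x \<bullet> a))"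
proof -
  have \<phi>: "\<phi> \<in> C1_c UNIV" and \<psi>: "\<psi> \<in> C1_c UNIV" using assms C1_c_mono by blast+
  \<comment> \<open>parts in the direction \<open>b\<close>, then translation by \<open>s *\<^sub>R a\<close>, moves the difference quotient from
    \<open>\<phi>\<close> to \<open>\<psi>\<close> and reverses its direction\<close>
  have step: "(LINT x|lborel. ((\<phi> (x + s *\<^sub>R a) - \<phi> x) * c) * (grad \<psi> x \<bullet> b))
      = - (LINT x|lborel. ((\<psi> (x + s *\<^sub>R (-a)) - \<psi> x) * c) * (grad \<phi> x \<bullet> b))" for s c
  proof -
    let ?\<phi>s = "\<lambda>x. \<phi> (x + s *\<^sub>R a)"
    have \<phi>s: "?\<phi>s \<in> C1_c UNIV" "grad ?\<phi>s = (\<lambda>x. grad \<phi> (x + s *\<^sub>R a))"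
      using C1_c_translate[OF \<phi>] by auto
    note [measurable] = C1_c_measurable[OF \<phi>] C1_c_measurable[OF \<psi>]
    obtain K where K: "compact K" "\<forall>x. x \<notin> K \<longrightarrow> \<psi> x = 0 \<and> grad \<psi> x = 0"
      using C1_cD(4)[OF \<psi>] by blast
    obtain L where L: "compact L" "\<forall>x. x \<notin> L \<longrightarrow> \<phi> x = 0 \<and> grad \<phi> x = 0"
      using C1_cD(4)[OF \<phi>] by blast
    have \<psi>s: "(\<lambda>x. \<psi> (x - s *\<^sub>R a)) \<in> C1_c UNIV"
      using C1_c_translate(1)[OF \<psi>, of "- s *\<^sub>R a"] by simp
    have "(LINT x|lborel. (\<phi> (x + s *\<^sub>R a) - \<phi> x) * (grad \<psi> x \<bullet> b))
        = (LINT x|lborel. ?\<phi>s x * (grad \<psi> x \<bullet> b)) - (LINT x|lborel. \<phi> x * (grad \<psi> x \<bullet> b))"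
      using K C1_cD(2)[OF \<phi>s(1)] C1_cD(2)[OF \<phi>] C1_cD(3)[OF \<psi>]
      unfolding left_diff_distrib
      by (intro Bochner_Integration.integral_diff integrable_continuous_compact_support[OF _ K(1)] continuous_intros) auto
    also have "\<dots> = - (LINT x|lborel. (grad \<phi> (x + s *\<^sub>R a) \<bullet> b) * \<psi> x) + (LINT x|lborel. (grad \<phi> x \<bullet> b) * \<psi> x)"
      by (simp add: C1_c_parts[OF \<phi>s(1) \<psi>] C1_c_parts[OF \<phi> \<psi>] \<phi>s(2))
    also have "(LINT x|lborel. (grad \<phi> (x + s *\<^sub>R a) \<bullet> b) * \<psi> x)
        = (LINT x|lborel. (grad \<phi> x \<bullet> b) * \<psi> (x - s *\<^sub>R a))"
      using integral_translate[of "\<lambda>x. (grad \<phi> x \<bullet> b) * \<psi> (x - s *\<^sub>R a)" "s *\<^sub>R a"] by simp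
    also have "- \<dots> + (LINT x|lborel. (grad \<phi> x \<bullet> b) * \<psi> x)
        = - (LINT x|lborel. (grad \<phi> x \<bullet> b) * (\<psi> (x - s *\<^sub>R a) - \<psi> x))"
      using L C1_cD(2)[OF \<psi>s(1)] C1_cD(2)[OF \<psi>] C1_cD(3)[OF \<phi>]
      unfolding right_diff_distrib
      by (subst Bochner_Integration.integral_diff)
         (auto intro!: integrable_continuous_compact_support[OF _ L(1)] continuous_intros)
    finally show ?thesis
      by (simp add: mult.assoc mult.left_commute[of _ c] mult.commute)
  qed
  have "(\<lambda>n. LINT x|lborel. ((\<phi> (x + inverse (real (Suc n)) *\<^sub>R a) - \<phi> x) * real (Suc n)) * (grad \<psi> x \<bullet> b))
           \<longlonglongrightarrow> (LINT x|lborel. (grad \<phi> x \<bullet> a) * (grad \<psi> x \<bullet> b))"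
    by (intro difference_quotients_tendsto \<phi> continuous_intros C1_cD(3)[OF \<psi>])
  moreover have "(\<lambda>n. - (LINT x|lborel. ((\<psi> (x + inverse (real (Suc n)) *\<^sub>R (-a)) - \<psi> x) * real (Suc n)) * (grad \<phi> x \<bullet> b)))
           \<longlonglongrightarrow> - (LINT x|lborel. (grad \<psi> x \<bullet> (-a)) * (grad \<phi> x \<bullet> b))"
    by (intro tendsto_minus difference_quotients_tendsto \<psi> continuous_intros C1_cD(3)[OF \<phi>])
  ultimately have "(LINT x|lborel. (grad \<phi> x \<bullet> a) * (grad \<psi> x \<bullet> b))
      = - (LINT x|lborel. (grad \<psi> x \<bullet> (-a)) * (grad \<phi> x \<bullet> b))"
    unfolding step by (rule LIMSEQ_unique)
  then show ?thesis by (simp add: mult.commute)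
qed

section \<open>The Gagliardo-Nirenberg inequality in the plane\<close>

lemma vector_2_eq: "(vector [x, y] :: real^2) = x *\<^sub>R axis 1 1 + y *\<^sub>R axis 2 1"
  by (simp add: vec_eq_iff forall_2 axis_def)

lemma measurable_vector_2 [measurable]:
  "(\<lambda>p. vector [fst p, snd p] :: real^2) \<in> borel_measurable (lborel \<Otimes>\<^sub>M lborel)"
  unfolding vector_2_eq by measurable

lemma lborel_vec_2: "distr (lborel \<Otimes>\<^sub>M lborel) borel (\<lambda>p. vector [fst p, snd p]) = (lborel :: (real^2) measure)"
proof (rule lborel_eqI[symmetric])
  fix l u :: "real^2"
  assume lu: "\<And>b. b \<in> Basis \<Longrightarrow> l \<bullet> b \<le> u \<bullet> b"
  have Basis: "(Basis :: (real^2) set) = (\<lambda>i. axis i 1) ` UNIV"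
    by (auto simp: Basis_vec_def)
  have le: "l $ i \<le> u $ i" for i
    using lu[of "axis i 1"] by (simp add: inner_axis Basis)
  have "emeasure (distr (lborel \<Otimes>\<^sub>M lborel) borel (\<lambda>p. vector [fst p, snd p])) (box l u)
      = emeasure (lborel \<Otimes>\<^sub>M lborel) ((\<lambda>p. vector [fst p, snd p]) -` box l u \<inter> space (lborel \<Otimes>\<^sub>M lborel))"
    by (rule emeasure_distr) auto
  also have "(\<lambda>p. vector [fst p, snd p]) -` box l u \<inter> space (lborel \<Otimes>\<^sub>M lborel)
      = {l $ 1<..<u $ 1} \<times> {l $ 2<..<u $ 2}"
    by (auto simp: mem_box_cart forall_2 space_pair_measure)
  also have "emeasure (lborel \<Otimes>\<^sub>M lborel) \<dots> = ennreal (u $ 1 - l $ 1) * ennreal (u $ 2 - l $ 2)"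
    by (subst lborel.emeasure_pair_measure_Times) (auto simp: le)
  also have "\<dots> = (\<Prod>b\<in>Basis. (u - l) \<bullet> b)"
    unfolding Basis using le
    by (subst prod.reindex) (auto simp: inj_on_def axis_eq_axis UNIV_2 inner_axis ennreal_mult)
  finally show "emeasure (distr (lborel \<Otimes>\<^sub>M lborel) borel (\<lambda>p. vector [fst p, snd p])) (box l u)
      = (\<Prod>b\<in>Basis. (u - l) \<bullet> b)" .
qed simp

lemma nn_integral_real_2:
  fixes f :: "real^2 \<Rightarrow> ennreal"
  assumes [measurable]: "f \<in> borel_measurable borel"
  shows "(\<integral>\<^sup>+z. f z \<partial>lborel) = (\<integral>\<^sup>+x. \<integral>\<^sup>+y. f (vector [x, y]) \<partial>lborel \<partial>lborel)"
    and "(\<integral>\<^sup>+z. f z \<partial>lborel) = (\<integral>\<^sup>+y. \<integral>\<^sup>+x. f (vector [x, y]) \<partial>lborel \<partial>lborel)"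
proof -
  have "(\<integral>\<^sup>+z. f z \<partial>lborel) = (\<integral>\<^sup>+p. f (vector [fst p, snd p]) \<partial>(lborel \<Otimes>\<^sub>M lborel))"
    by (subst lborel_vec_2[symmetric], subst nn_integral_distr) auto
  also have "\<dots> = (\<integral>\<^sup>+x. \<integral>\<^sup>+y. f (vector [x, y]) \<partial>lborel \<partial>lborel)"
    by (subst lborel.nn_integral_fst[symmetric]) auto
  finally show 1: "(\<integral>\<^sup>+z. f z \<partial>lborel) = (\<integral>\<^sup>+x. \<integral>\<^sup>+y. f (vector [x, y]) \<partial>lborel \<partial>lborel)" .
  have [measurable]: "(\<lambda>(x, y). f (vector [x, y])) \<in> borel_measurable (lborel \<Otimes>\<^sub>M lborel)"
    unfolding vector_2_eq by measurable
  show "(\<integral>\<^sup>+z. f z \<partial>lborel) = (\<integral>\<^sup>+y. \<integral>\<^sup>+x. f (vector [x, y]) \<partial>lborel \<partial>lborel)"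
    unfolding 1 by (rule lborel_pair.Fubini'[symmetric]) measurable
qed

text \<open>The fundamental theorem of calculus, started at a zero of the function.\<close>

lemma abs_le_nn_integral_abs_deriv:
  fixes g g' :: "real \<Rightarrow> real"
  assumes D: "\<And>x. (g has_field_derivative g' x) (at x)" and C: "continuous_on UNIV g'"
    and "a \<le> x" "g a = 0"
  shows "ennreal \<bar>g x\<bar> \<le> (\<integral>\<^sup>+s. ennreal \<bar>g' s\<bar> \<partial>lborel)"
proof -
  let ?h = "\<lambda>s. indicator {a..x} s *\<^sub>R g' s"
  have int: "integrable lborel ?h"
    using C by (intro borel_integrable_compact) (auto intro: continuous_on_subset)
  have "(LINT s|lborel. ?h s) = g x - g a"
    using D C \<open>a \<le> x\<close>
    by (intro integral_FTC_atLeastAtMost)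
       (auto intro: continuous_on_subset has_field_derivative_at_within
             simp: has_real_derivative_iff_has_vector_derivative[symmetric])
  then have "ennreal \<bar>g x\<bar> = ennreal (norm (LINT s|lborel. ?h s))"
    using \<open>g a = 0\<close> by simp
  also have "\<dots> \<le> (\<integral>\<^sup>+s. ennreal (norm (?h s)) \<partial>lborel)"
    by (rule integral_norm_bound_ennreal[OF int])
  also have "\<dots> \<le> (\<integral>\<^sup>+s. ennreal \<bar>g' s\<bar> \<partial>lborel)"
    by (intro nn_integral_mono) (auto simp: indicator_def)
  finally show ?thesis .
qed

lemma C1_c_le_line_integral:
  assumes \<phi>: "\<phi> \<in> C1_c \<Omega>" and e: "norm e = 1"
  shows "ennreal \<bar>\<phi> z\<bar> \<le> (\<integral>\<^sup>+s. ennreal (norm (grad \<phi> (z + s *\<^sub>R e))) \<partial>lborel)"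
proof -
  obtain K where K: "compact K" "\<forall>x. x \<notin> K \<longrightarrow> \<phi> x = 0"
    using C1_cD(4)[OF \<phi>] by blast
  obtain r where r: "\<And>x. x \<in> K \<Longrightarrow> norm x \<le> r"
    using compact_imp_bounded[OF K(1)] unfolding bounded_iff by blast
  \<comment> \<open>a parameter so far to the left that the line has left the support on that side\<close>
  define a where "a = - (\<bar>r\<bar> + norm z + 1)"
  have "norm (a *\<^sub>R e) - norm z \<le> norm (z + a *\<^sub>R e)"
    using norm_diff_ineq[of "a *\<^sub>R e" z] by (simp add: add.commute)
  then have "norm (z + a *\<^sub>R e) > r"
    using e by (simp add: a_def)
  then have a: "\<phi> (z + a *\<^sub>R e) = 0"
    using K(2) r by force
  have D: "((\<lambda>s. \<phi> (z + s *\<^sub>R e)) has_field_derivative grad \<phi> (z + s *\<^sub>R e) \<bullet> e) (at s)" for s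
  proof -
    have line: "((\<lambda>s::real. z + s *\<^sub>R e) has_derivative (\<lambda>s. s *\<^sub>R e)) (at s)"
      by (auto intro!: derivative_eq_intros)
    have "((\<lambda>s. \<phi> (z + s *\<^sub>R e)) has_derivative (\<lambda>t. grad \<phi> (z + s *\<^sub>R e) \<bullet> (t *\<^sub>R e))) (at s)"
      by (rule has_derivative_compose[OF line C1_cD(1)[OF \<phi>]])
    moreover have "(\<lambda>t. grad \<phi> (z + s *\<^sub>R e) \<bullet> (t *\<^sub>R e)) = (*) (grad \<phi> (z + s *\<^sub>R e) \<bullet> e)"
      by (simp add: fun_eq_iff)
    ultimately show ?thesis by (simp only: has_field_derivative_def)
  qed
  have C: "continuous_on UNIV (\<lambda>s. grad \<phi> (z + s *\<^sub>R e) \<bullet> e)"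
    by (intro continuous_intros continuous_on_compose2[OF C1_cD(3)[OF \<phi>]]) auto
  have "a \<le> 0" unfolding a_def using abs_ge_zero[of r] norm_ge_zero[of z] by linarith
  then have "ennreal \<bar>\<phi> (z + 0 *\<^sub>R e)\<bar> \<le> (\<integral>\<^sup>+s. ennreal \<bar>grad \<phi> (z + s *\<^sub>R e) \<bullet> e\<bar> \<partial>lborel)"
    by (rule abs_le_nn_integral_abs_deriv[OF D C _ a])
  also have "\<dots> \<le> (\<integral>\<^sup>+s. ennreal (norm (grad \<phi> (z + s *\<^sub>R e))) \<partial>lborel)"
    using e Cauchy_Schwarz_ineq2[of _ e] by (intro nn_integral_mono ennreal_leI) simp
  finally show ?thesis by simp
qed

text \<open>A value of the function is at most the integral of the gradient along the horizontal and along
  the vertical line through the point.  The product of the two integrals bounds the square, and it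
  has separated variables.\<close>

lemma Gagliardo_Nirenberg:
  assumes \<phi>: "\<phi> \<in> C1_c \<Omega>"
  shows "(\<integral>\<^sup>+z. (ennreal \<bar>\<phi> z\<bar>)\<^sup>2 \<partial>lborel) \<le> (\<integral>\<^sup>+z. ennreal (norm (grad \<phi> z)) \<partial>lborel)\<^sup>2"
proof -
  note [measurable] = C1_c_measurable[OF \<phi>]
  define f where "f x y = ennreal (norm (grad \<phi> (vector [x, y])))" for x y
  have [measurable]: "(\<lambda>(x, y). f x y) \<in> borel_measurable (lborel \<Otimes>\<^sub>M lborel)"
    "(\<lambda>(y, x). f x y) \<in> borel_measurable (lborel \<Otimes>\<^sub>M lborel)"
    unfolding f_def vector_2_eq by measurable
  define A where "A y = (\<integral>\<^sup>+x. f x y \<partial>lborel)" for y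
  define B where "B x = (\<integral>\<^sup>+y. f x y \<partial>lborel)" for x
  have [measurable]: "A \<in> borel_measurable lborel" "B \<in> borel_measurable lborel"
    unfolding A_def B_def by measurable
  have shift: "(\<integral>\<^sup>+s. h (c + s) \<partial>lborel) = (\<integral>\<^sup>+s. h s \<partial>lborel)"
    if [measurable]: "h \<in> borel_measurable borel" for h :: "real \<Rightarrow> ennreal" and c
    by (subst (2) lborel_distr_plus[of c, symmetric], subst nn_integral_distr) auto
  have *: "ennreal \<bar>\<phi> (vector [x, y])\<bar> \<le> A y" "ennreal \<bar>\<phi> (vector [x, y])\<bar> \<le> B x" for x y
  proof -
    have m: "(\<lambda>s. f s y) \<in> borel_measurable borel" "(\<lambda>s. f x s) \<in> borel_measurable borel"
      unfolding f_def vector_2_eq by measurable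
    have "vector [x, y] + s *\<^sub>R axis 1 1 = (vector [x + s, y] :: real^2)"
      "vector [x, y] + s *\<^sub>R axis 2 1 = (vector [x, y + s] :: real^2)" for s
      by (simp_all add: vector_2_eq algebra_simps)
    then show "ennreal \<bar>\<phi> (vector [x, y])\<bar> \<le> A y" "ennreal \<bar>\<phi> (vector [x, y])\<bar> \<le> B x"
      using C1_c_le_line_integral[OF \<phi>, of "axis 1 1" "vector [x, y]"]
        C1_c_le_line_integral[OF \<phi>, of "axis 2 1" "vector [x, y]"]
        shift[OF m(1), of x] shift[OF m(2), of y]
      by (simp_all add: A_def B_def f_def)
  qed
  have "(\<integral>\<^sup>+z. (ennreal \<bar>\<phi> z\<bar>)\<^sup>2 \<partial>lborel)
      = (\<integral>\<^sup>+x. \<integral>\<^sup>+y. (ennreal \<bar>\<phi> (vector [x, y])\<bar>)\<^sup>2 \<partial>lborel \<partial>lborel)"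
    by (rule nn_integral_real_2(1)) measurable
  also have "\<dots> \<le> (\<integral>\<^sup>+x. \<integral>\<^sup>+y. B x * A y \<partial>lborel \<partial>lborel)"
    unfolding power2_eq_square by (intro nn_integral_mono mult_mono * ) auto
  also have "\<dots> = (\<integral>\<^sup>+x. B x \<partial>lborel) * (\<integral>\<^sup>+y. A y \<partial>lborel)"
    by (simp add: nn_integral_cmult nn_integral_multc)
  also have "(\<integral>\<^sup>+x. B x \<partial>lborel) = (\<integral>\<^sup>+z. ennreal (norm (grad \<phi> z)) \<partial>lborel)"
    unfolding B_def f_def by (rule nn_integral_real_2(1)[symmetric]) measurable
  also have "(\<integral>\<^sup>+y. A y \<partial>lborel) = (\<integral>\<^sup>+z. ennreal (norm (grad \<phi> z)) \<partial>lborel)"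
    unfolding A_def f_def by (rule nn_integral_real_2(2)[symmetric]) measurable
  finally show ?thesis by (simp add: power2_eq_square)
qed

text \<open>Applied to powers of the function, the Gagliardo-Nirenberg inequality and the Cauchy-Schwarz
  inequality raise the exponent of integrability by two at a time.  The indicator makes the induction
  start at the area of the set, so that the first step, from exponent zero to two, is Poincare's inequality.\<close>

lemma Sobolev_even_power:
  assumes \<phi>: "\<phi> \<in> C1_c \<Omega>" and [measurable]: "\<Omega> \<in> sets borel"
  shows "(\<integral>\<^sup>+z. indicator \<Omega> z * (ennreal \<bar>\<phi> z\<bar>) ^ (2 * n) \<partial>lborel)
       \<le> (fact n)\<^sup>2 * emeasure lborel \<Omega> * (\<integral>\<^sup>+z. (ennreal (norm (grad \<phi> z)))\<^sup>2 \<partial>lborel) ^ n"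
proof (induction n)
  case 0
  then show ?case by simp
next
  case (Suc n)
  note [measurable] = C1_c_measurable[OF \<phi>]
  let ?D = "\<integral>\<^sup>+z. (ennreal (norm (grad \<phi> z)))\<^sup>2 \<partial>lborel"
  have pow: "(\<lambda>z. \<phi> z ^ Suc n) \<in> C1_c \<Omega>"
    "grad (\<lambda>z. \<phi> z ^ Suc n) = (\<lambda>z. (real (Suc n) * \<phi> z ^ n) *\<^sub>R grad \<phi> z)"
    using C1_c_power[OF \<phi>] by auto
  obtain K where K: "K \<subseteq> \<Omega>" "\<forall>z. z \<notin> K \<longrightarrow> \<phi> z = 0 \<and> grad \<phi> z = 0"
    using C1_cD(4)[OF \<phi>] by blast
  have out: "\<phi> z = 0 \<and> grad \<phi> z = 0" if "z \<notin> \<Omega>" for z using K that by blast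
  have "(\<integral>\<^sup>+z. indicator \<Omega> z * (ennreal \<bar>\<phi> z\<bar>) ^ (2 * Suc n) \<partial>lborel)
      = (\<integral>\<^sup>+z. (ennreal \<bar>\<phi> z ^ Suc n\<bar>)\<^sup>2 \<partial>lborel)"
  proof (rule nn_integral_cong)
    fix z
    show "indicator \<Omega> z * (ennreal \<bar>\<phi> z\<bar>) ^ (2 * Suc n) = (ennreal \<bar>\<phi> z ^ Suc n\<bar>)\<^sup>2"
      using out[of z]
      by (cases "z \<in> \<Omega>") (auto simp: ennreal_power power_abs[symmetric] power_mult[symmetric] mult.commute power_Suc[symmetric] simp del: power_Suc)
  qed
  also have "\<dots> \<le> (\<integral>\<^sup>+z. ennreal (norm (grad (\<lambda>z. \<phi> z ^ Suc n) z)) \<partial>lborel)\<^sup>2"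
    by (rule Gagliardo_Nirenberg[OF pow(1)])
  also have "(\<integral>\<^sup>+z. ennreal (norm (grad (\<lambda>z. \<phi> z ^ Suc n) z)) \<partial>lborel)
      = (\<integral>\<^sup>+z. of_nat (Suc n) * ((indicator \<Omega> z * (ennreal \<bar>\<phi> z\<bar>) ^ n) * ennreal (norm (grad \<phi> z))) \<partial>lborel)"
  proof (rule nn_integral_cong)
    fix z
    show "ennreal (norm (grad (\<lambda>z. \<phi> z ^ Suc n) z))
       = of_nat (Suc n) * ((indicator \<Omega> z * (ennreal \<bar>\<phi> z\<bar>) ^ n) * ennreal (norm (grad \<phi> z)))"
      unfolding pow(2) using out[of z]
      by (cases "z \<in> \<Omega>")
         (auto simp: abs_mult power_abs ennreal_mult ennreal_power mult.assoc ennreal_of_nat_eq_real_of_nat simp del: of_nat_Suc)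
  qed
  also have "\<dots> = of_nat (Suc n) * (\<integral>\<^sup>+z. (indicator \<Omega> z * (ennreal \<bar>\<phi> z\<bar>) ^ n) * ennreal (norm (grad \<phi> z)) \<partial>lborel)"
    by (rule nn_integral_cmult) measurable
  also have "\<dots>\<^sup>2 \<le> (of_nat (Suc n))\<^sup>2 * ((\<integral>\<^sup>+z. (indicator \<Omega> z * (ennreal \<bar>\<phi> z\<bar>) ^ n)\<^sup>2 \<partial>lborel) * ?D)"
    unfolding power_mult_distrib[of "of_nat (Suc n)"]
    by (intro mult_left_mono Cauchy_Schwarz_nn_integral) auto
  also have "(\<integral>\<^sup>+z. (indicator \<Omega> z * (ennreal \<bar>\<phi> z\<bar>) ^ n)\<^sup>2 \<partial>lborel)
      = (\<integral>\<^sup>+z. indicator \<Omega> z * (ennreal \<bar>\<phi> z\<bar>) ^ (2 * n) \<partial>lborel)"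
    by (intro nn_integral_cong) (auto simp: indicator_def power_mult[symmetric] mult.commute)
  also have "(of_nat (Suc n))\<^sup>2 * ((\<integral>\<^sup>+z. indicator \<Omega> z * (ennreal \<bar>\<phi> z\<bar>) ^ (2 * n) \<partial>lborel) * ?D)
      \<le> (of_nat (Suc n))\<^sup>2 * (((fact n)\<^sup>2 * emeasure lborel \<Omega> * ?D ^ n) * ?D)"
    using Suc by (intro mult_left_mono mult_right_mono) auto
  also have "\<dots> = (fact (Suc n))\<^sup>2 * emeasure lborel \<Omega> * ?D ^ Suc n"
    by (simp add: power_mult_distrib mult_ac)
  finally show ?case .
qed

lemma C1_c_integrable_pow:
  assumes "\<phi> \<in> C1_c \<Omega>"
  shows "integrable lborel (\<lambda>z. \<phi> z ^ Suc n)" and "integrable lborel (\<lambda>z. (norm (grad \<phi> z)) ^ Suc n)"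
proof -
  obtain K where K: "compact K" "\<forall>z. z \<notin> K \<longrightarrow> \<phi> z = 0 \<and> grad \<phi> z = 0"
    using C1_cD(4)[OF assms] by blast
  show "integrable lborel (\<lambda>z. \<phi> z ^ Suc n)" "integrable lborel (\<lambda>z. (norm (grad \<phi> z)) ^ Suc n)"
    using C1_cD(2,3)[OF assms] K(2)
    by (auto intro!: integrable_continuous_compact_support[OF _ K(1)] continuous_intros)
qed

lemma Sobolev_even_power_real:
  assumes \<phi>: "\<phi> \<in> C1_c \<Omega>" and \<Omega>: "\<Omega> \<in> sets borel" "bounded \<Omega>" and n: "n > 0"
  shows "(LINT z|lborel. \<phi> z ^ (2 * n))
       \<le> (fact n)\<^sup>2 * measure lborel \<Omega> * (LINT z|lborel. (norm (grad \<phi> z))\<^sup>2) ^ n"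
proof -
  have int: "integrable lborel (\<lambda>z. \<phi> z ^ (2 * n))" "integrable lborel (\<lambda>z. (norm (grad \<phi> z))\<^sup>2)"
    using C1_c_integrable_pow(1)[OF \<phi>, of "2 * n - 1"] C1_c_integrable_pow(2)[OF \<phi>, of 1] n
    by (simp_all add: numeral_2_eq_2)
  obtain K where K: "K \<subseteq> \<Omega>" "\<forall>z. z \<notin> K \<longrightarrow> \<phi> z = 0"
    using C1_cD(4)[OF \<phi>] by blast
  have out: "\<phi> z = 0" if "z \<notin> \<Omega>" for z using K that by blast
  have fin: "emeasure lborel \<Omega> = ennreal (measure lborel \<Omega>)"
    using emeasure_bounded_finite[OF \<Omega>(2)] by (simp add: emeasure_eq_ennreal_measure)
  have "ennreal (LINT z|lborel. \<phi> z ^ (2 * n)) = (\<integral>\<^sup>+z. ennreal (\<phi> z ^ (2 * n)) \<partial>lborel)"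
    by (rule nn_integral_eq_integral[symmetric]) (use int in auto)
  also have "\<dots> = (\<integral>\<^sup>+z. indicator \<Omega> z * (ennreal \<bar>\<phi> z\<bar>) ^ (2 * n) \<partial>lborel)"
  proof (rule nn_integral_cong)
    fix z
    show "ennreal (\<phi> z ^ (2 * n)) = indicator \<Omega> z * (ennreal \<bar>\<phi> z\<bar>) ^ (2 * n)"
      using out[of z] n by (cases "z \<in> \<Omega>") (auto simp: ennreal_power power_even_abs)
  qed
  also have "\<dots> \<le> (fact n)\<^sup>2 * emeasure lborel \<Omega> * (\<integral>\<^sup>+z. (ennreal (norm (grad \<phi> z)))\<^sup>2 \<partial>lborel) ^ n"
    by (rule Sobolev_even_power[OF \<phi> \<Omega>(1)])
  also have "(\<integral>\<^sup>+z. (ennreal (norm (grad \<phi> z)))\<^sup>2 \<partial>lborel) = ennreal (LINT z|lborel. (norm (grad \<phi> z))\<^sup>2)"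
    by (subst nn_integral_eq_integral[symmetric]) (use int in \<open>auto simp: ennreal_power\<close>)
  also have "(fact n)\<^sup>2 * emeasure lborel \<Omega> * ennreal (LINT z|lborel. (norm (grad \<phi> z))\<^sup>2) ^ n
      = ennreal ((fact n)\<^sup>2 * measure lborel \<Omega> * (LINT z|lborel. (norm (grad \<phi> z))\<^sup>2) ^ n)"
  proof -
    have "(fact n :: ennreal) = ennreal (fact n)"
      by (metis ennreal_of_nat_eq_real_of_nat of_nat_fact)
    then show ?thesis
      by (simp add: fin ennreal_mult ennreal_power)
  qed
  finally show ?thesis
    by (subst (asm) ennreal_le_iff) auto
qed

section \<open>Densities as functionals on test functions\<close>

lemma set_integral_lebesgue_eq_lborel:
  fixes f :: "real^2 \<Rightarrow> 'b::{banach, second_countable_topology}"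
  assumes "f \<in> borel_measurable borel" "\<And>x. x \<notin> \<Omega> \<Longrightarrow> f x = 0"
  shows "(LINT x:\<Omega>|lebesgue. f x) = (LINT x|lborel. f x)"
proof -
  have "(\<lambda>x. indicator \<Omega> x *\<^sub>R f x) = f"
    using assms(2) by (auto simp: fun_eq_iff indicator_def)
  then show ?thesis
    using assms(1) by (simp add: set_lebesgue_integral_def integral_completion)
qed

lemma L1_loc_test_integrable:
  fixes v :: "real^2 \<Rightarrow> 'b::euclidean_space" and w :: "real^2 \<Rightarrow> 'b"
  assumes v: "v \<in> L1_loc \<Omega>" and w: "continuous_on UNIV w"
    and K: "compact K" "K \<subseteq> \<Omega>" "\<And>x. x \<notin> K \<Longrightarrow> w x = 0"
  shows "set_integrable lebesgue \<Omega> (\<lambda>x. w x \<bullet> v x)"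
proof -
  have "bounded (w ` K)"
    using K(1) w by (intro compact_imp_bounded compact_continuous_image) (auto intro: continuous_on_subset)
  then obtain B where B: "\<And>x. x \<in> K \<Longrightarrow> norm (w x) \<le> B"
    unfolding bounded_iff by blast
  have vK: "integrable lebesgue (\<lambda>x. indicator K x *\<^sub>R v x)"
    using v K by (simp add: L1_loc_def set_integrable_def)
  have [measurable]: "w \<in> borel_measurable lebesgue"
    using w by (intro measurable_completion) (simp add: borel_measurable_continuous_onI)
  have eq: "indicator \<Omega> x *\<^sub>R (w x \<bullet> v x) = w x \<bullet> (indicator K x *\<^sub>R v x)" for x
    using K by (auto simp: indicator_def)
  have "integrable lebesgue (\<lambda>x. w x \<bullet> (indicator K x *\<^sub>R v x))"
  proof (rule Bochner_Integration.integrable_bound)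
    show "integrable lebesgue (\<lambda>x. B *\<^sub>R norm (indicator K x *\<^sub>R v x))"
      by (intro integrable_scaleR_right integrable_norm vK)
    show "(\<lambda>x. w x \<bullet> (indicator K x *\<^sub>R v x)) \<in> borel_measurable lebesgue"
      using borel_measurable_integrable[OF vK] by measurable
    show "AE x in lebesgue. norm (w x \<bullet> (indicator K x *\<^sub>R v x))
            \<le> norm (B *\<^sub>R norm (indicator K x *\<^sub>R v x))"
    proof (intro AE_I2)
      fix x
      have "norm (w x \<bullet> (indicator K x *\<^sub>R v x)) \<le> norm (w x) * norm (indicator K x *\<^sub>R v x)"
        unfolding real_norm_def by (rule Cauchy_Schwarz_ineq2)
      also have "\<dots> \<le> norm (B *\<^sub>R norm (indicator K x *\<^sub>R v x))"
      proof (cases "x \<in> K")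
        case True
        then show ?thesis using B[OF True]
          by (auto simp: abs_mult intro!: mult_right_mono order_trans[OF _ abs_ge_self])
      qed simp
      finally show "norm (w x \<bullet> (indicator K x *\<^sub>R v x)) \<le> norm (B *\<^sub>R norm (indicator K x *\<^sub>R v x))" .
    qed
  qed
  then show ?thesis
    unfolding set_integrable_def eq .
qed

lemma L1_loc_test_integrable_real:
  fixes \<rho> :: "real^2 \<Rightarrow> real"
  assumes \<rho>: "\<rho> \<in> L1_loc \<Omega>" and \<phi>: "\<phi> \<in> C1_c \<Omega>"
  shows "set_integrable lebesgue \<Omega> (\<lambda>x. \<rho> x * \<phi> x)"
proof -
  obtain K where "compact K" "K \<subseteq> \<Omega>" "\<forall>x. x \<notin> K \<longrightarrow> \<phi> x = 0"
    using C1_cD(4)[OF \<phi>] by blast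
  then have "set_integrable lebesgue \<Omega> (\<lambda>x. \<phi> x \<bullet> \<rho> x)"
    using C1_cD(2)[OF \<phi>] \<rho> by (intro L1_loc_test_integrable) auto
  then show ?thesis by (simp add: mult.commute)
qed

text \<open>By homogeneity it suffices to treat functions of Dirichlet energy at most one.  For those,
  Young's inequality separates the density from the test function, and the conjugate exponent is
  dominated by an even integer.\<close>

lemma Lp_bounded_functional:
  fixes \<rho> :: "real^2 \<Rightarrow> real"
  assumes \<Omega>: "open \<Omega>" "bounded \<Omega>" and p: "p > 1" and \<rho>: "\<rho> \<in> Lp p \<Omega>" "\<rho> \<in> L1_loc \<Omega>"
  shows "\<exists>C. \<forall>\<phi>\<in>C1_c \<Omega>. \<bar>LINT x:\<Omega>|lebesgue. \<rho> x * \<phi> x\<bar>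
            \<le> C * sqrt (LINT x|lborel. (norm (grad \<phi> x))\<^sup>2)"
proof -
  define l where "l \<phi> = (LINT x:\<Omega>|lebesgue. \<rho> x * \<phi> x)" for \<phi>
  define D where "D \<phi> = (LINT x|lborel. (norm (grad \<phi> x))\<^sup>2)" for \<phi> :: "real^2 \<Rightarrow> real"
  define q where "q = p / (p - 1)"
  have q: "q > 1" "1 / p + 1 / q = 1"
    using p by (auto simp: q_def field_simps)
  obtain n :: nat where n: "q \<le> real n" using real_arch_simple by blast
  have "n > 0" using n q by (cases n) auto
  define R where "R = (LINT x:\<Omega>|lebesgue. norm (\<rho> x) powr p)"
  define C where "C = R + measure lborel \<Omega> + (fact n)\<^sup>2 * measure lborel \<Omega>"
  have [measurable]: "\<Omega> \<in> sets borel" using \<Omega> by auto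
  have small: "\<bar>l \<phi>\<bar> \<le> C" if \<phi>: "\<phi> \<in> C1_c \<Omega>" and "D \<phi> \<le> 1" for \<phi>
  proof -
    have pt: "\<bar>\<rho> x * \<phi> x\<bar> \<le> norm (\<rho> x) powr p + 1 + \<phi> x ^ (2 * n)" for x
    proof -
      have "\<bar>\<rho> x * \<phi> x\<bar> = \<bar>\<rho> x\<bar> * \<bar>\<phi> x\<bar>" by (simp add: abs_mult)
      also have "\<dots> \<le> \<bar>\<rho> x\<bar> powr p / p + \<bar>\<phi> x\<bar> powr q / q"
        using p q by (intro Youngs_inequality) auto
      also have "\<dots> \<le> \<bar>\<rho> x\<bar> powr p + \<bar>\<phi> x\<bar> powr q"
        using p q by (intro add_mono) (auto simp: divide_le_eq intro: order_trans[OF _ mult_left_mono[of 1]])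
      also have "\<bar>\<phi> x\<bar> powr q \<le> 1 + \<phi> x ^ (2 * n)"
      proof (cases "\<bar>\<phi> x\<bar> \<le> 1")
        case True
        then have "\<bar>\<phi> x\<bar> powr q \<le> 1" using q by (intro powr_le1) auto
        moreover have "0 \<le> \<phi> x ^ (2 * n)" by simp
        ultimately show ?thesis by linarith
      next
        case False
        then have "\<bar>\<phi> x\<bar> powr q \<le> \<bar>\<phi> x\<bar> powr real (2 * n)" using n by (intro powr_mono) auto
        also have "\<dots> = \<bar>\<phi> x\<bar> ^ (2 * n)" using False by (intro powr_realpow) auto
        also have "\<dots> = \<phi> x ^ (2 * n)" by (simp add: power_even_abs)
        finally show ?thesis by simp
      qed
      finally show ?thesis by simp
    qed
    have i1: "integrable lebesgue (\<lambda>x. indicator \<Omega> x * (norm (\<rho> x) powr p))"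
      using \<rho>(1) by (simp add: Lp_def set_integrable_def)
    have i2: "integrable lebesgue (\<lambda>x. indicator \<Omega> x :: real)"
      using emeasure_bounded_finite[OF \<Omega>(2)] by (simp add: integrable_completion integrable_indicator_iff)
    have i3: "integrable lborel (\<lambda>x. \<phi> x ^ (2 * n))"
      using C1_c_integrable_pow(1)[OF \<phi>, of "2 * n - 1"] \<open>n > 0\<close> by simp
    have i3': "integrable lebesgue (\<lambda>x. \<phi> x ^ (2 * n))"
      using i3 by (simp add: integrable_completion C1_c_measurable[OF \<phi>])
    have "\<bar>l \<phi>\<bar> \<le> (LINT x|lebesgue. norm (indicator \<Omega> x * (\<rho> x * \<phi> x)))"
      unfolding l_def set_lebesgue_integral_def real_scaleR_def
      by (subst real_norm_def[symmetric]) (rule integral_norm_bound)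
    also have "\<dots> \<le> (LINT x|lebesgue. indicator \<Omega> x * (norm (\<rho> x) powr p) + indicator \<Omega> x + \<phi> x ^ (2 * n))"
    proof (rule integral_mono)
      show "integrable lebesgue (\<lambda>x. norm (indicator \<Omega> x * (\<rho> x * \<phi> x)))"
        using L1_loc_test_integrable_real[OF \<rho>(2) \<phi>] by (intro integrable_norm) (simp add: set_integrable_def)
      show "integrable lebesgue (\<lambda>x. indicator \<Omega> x * (norm (\<rho> x) powr p) + indicator \<Omega> x + \<phi> x ^ (2 * n))"
        using i1 i2 i3' by (intro Bochner_Integration.integrable_add)
      show "norm (indicator \<Omega> x * (\<rho> x * \<phi> x))
          \<le> indicator \<Omega> x * (norm (\<rho> x) powr p) + indicator \<Omega> x + \<phi> x ^ (2 * n)" for x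
        using pt[of x] by (cases "x \<in> \<Omega>") (auto simp: abs_mult)
    qed
    also have "\<dots> = R + measure lborel \<Omega> + (LINT x|lebesgue. \<phi> x ^ (2 * n))"
      using i1 i2 i3' by (simp add: R_def set_lebesgue_integral_def)
    also have "(LINT x|lebesgue. \<phi> x ^ (2 * n)) = (LINT x|lborel. \<phi> x ^ (2 * n))"
      using C1_c_measurable[OF \<phi>] by (intro integral_completion) measurable
    also have "\<dots> \<le> (fact n)\<^sup>2 * measure lborel \<Omega> * D \<phi> ^ n"
      unfolding D_def using \<Omega> \<open>n > 0\<close> by (intro Sobolev_even_power_real[OF \<phi>]) auto
    also have "\<dots> \<le> (fact n)\<^sup>2 * measure lborel \<Omega> * 1"
      using \<open>D \<phi> \<le> 1\<close> by (intro mult_left_mono power_le_one) (auto simp: D_def)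
    finally show ?thesis by (simp add: C_def)
  qed
  have scale: "(\<lambda>x. c * \<phi> x) \<in> C1_c \<Omega>" "l (\<lambda>x. c * \<phi> x) = c * l \<phi>" "D (\<lambda>x. c * \<phi> x) = c\<^sup>2 * D \<phi>"
    if "\<phi> \<in> C1_c \<Omega>" for \<phi> c
  proof -
    show "(\<lambda>x. c * \<phi> x) \<in> C1_c \<Omega>"
      using C1_c_lincomb(1)[OF C1_c_zero(1) that, of c] by simp
    have g: "grad (\<lambda>x. c * \<phi> x) = (\<lambda>x. c *\<^sub>R grad \<phi> x)"
      using C1_c_lincomb(2)[OF C1_c_zero(1) that, of c] by (simp add: C1_c_zero(2))
    show "l (\<lambda>x. c * \<phi> x) = c * l \<phi>"
      by (simp add: l_def mult.left_commute[of _ c])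
    show "D (\<lambda>x. c * \<phi> x) = c\<^sup>2 * D \<phi>"
      by (simp add: D_def g power_mult_distrib)
  qed
  have D0: "D \<phi> \<ge> 0" for \<phi> by (simp add: D_def)
  have scaled: "\<bar>c * l \<phi>\<bar> \<le> C" if \<phi>: "\<phi> \<in> C1_c \<Omega>" and "c\<^sup>2 * D \<phi> \<le> 1" for \<phi> c
    using small[OF scale(1)[OF \<phi>, of c]] that(2) by (simp only: scale(2,3)[OF \<phi>])
  have "\<bar>l \<phi>\<bar> \<le> C * sqrt (D \<phi>)" if \<phi>: "\<phi> \<in> C1_c \<Omega>" for \<phi>
  proof (cases "D \<phi> = 0")
    case True
    have "l \<phi> = 0"
    proof (rule ccontr)
      assume "l \<phi> \<noteq> 0"
      \<comment> \<open>a multiple of zero energy on which the functional takes the value \<open>\<bar>C\<bar> + 1\<close>\<close>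
      then show False
        using scaled[OF \<phi>, of "(\<bar>C\<bar> + 1) / l \<phi>"] True by simp
    qed
    then show ?thesis using True by simp
  next
    case False
    then have pos: "sqrt (D \<phi>) > 0" using D0[of \<phi>] by simp
    have "\<bar>(1 / sqrt (D \<phi>)) * l \<phi>\<bar> \<le> C"
      using False D0[of \<phi>] by (intro scaled[OF \<phi>]) (simp add: power_divide)
    then show ?thesis
      using pos by (simp add: abs_mult field_simps)
  qed
  then show ?thesis unfolding l_def D_def by blast
qed

section \<open>Completeness and minimization\<close>

text \<open>The Riesz-Fischer argument: since \<open>d \<le> 2 ^ n * d\<^sup>2 + (1 / 2) ^ n\<close>, the increments are almost
  everywhere absolutely summable.\<close>

lemma rapidly_Cauchy_L2_limit:
  fixes f :: "nat \<Rightarrow> 'a \<Rightarrow> 'b::{banach, second_countable_topology}"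
  assumes [measurable]: "\<And>n. f n \<in> borel_measurable M"
    and cauchy: "\<And>n m. n \<le> m \<Longrightarrow> (\<integral>\<^sup>+x. ennreal ((norm (f m x - f n x))\<^sup>2) \<partial>M) \<le> ennreal (c * (1/4) ^ n)"
  shows "\<exists>g\<in>borel_measurable M. \<forall>n. (\<integral>\<^sup>+x. ennreal ((norm (f n x - g x))\<^sup>2) \<partial>M) \<le> ennreal (c * (1/4) ^ n)"
proof -
  define d where "d n x = f (Suc n) x - f n x" for n x
  define g where "g x = lim (\<lambda>n. f n x)" for x
  have [measurable]: "g \<in> borel_measurable M" "\<And>n. d n \<in> borel_measurable M"
    unfolding g_def d_def by measurable
  have "(\<integral>\<^sup>+x. (\<Sum>n. ennreal (2 ^ n * (norm (d n x))\<^sup>2)) \<partial>M)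
      = (\<Sum>n. \<integral>\<^sup>+x. ennreal (2 ^ n * (norm (d n x))\<^sup>2) \<partial>M)"
    by (rule nn_integral_suminf) measurable
  also have "\<dots> \<le> (\<Sum>n. ennreal (\<bar>c\<bar> * (1/2) ^ n))"
  proof (intro suminf_le summableI)
    fix n
    have "(\<integral>\<^sup>+x. ennreal (2 ^ n * (norm (d n x))\<^sup>2) \<partial>M) = ennreal (2 ^ n) * (\<integral>\<^sup>+x. ennreal ((norm (d n x))\<^sup>2) \<partial>M)"
      by (simp add: ennreal_mult nn_integral_cmult)
    also have "\<dots> \<le> ennreal (2 ^ n) * ennreal (c * (1/4) ^ n)"
      using cauchy[of n "Suc n"] unfolding d_def by (intro mult_left_mono) auto
    also have "\<dots> = ennreal (2 ^ n * (c * (1/4) ^ n))"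
      by (simp add: ennreal_mult'[symmetric])
    also have "2 ^ n * (c * (1/4) ^ n) = c * (2 * (1/4)) ^ n"
      by (simp only: power_mult_distrib mult_ac)
    also have "ennreal (c * (2 * (1/4)) ^ n) \<le> ennreal (\<bar>c\<bar> * (1/2) ^ n)"
      by (intro ennreal_leI) (simp add: mult_right_mono)
    finally show "(\<integral>\<^sup>+x. ennreal (2 ^ n * (norm (d n x))\<^sup>2) \<partial>M) \<le> ennreal (\<bar>c\<bar> * (1/2) ^ n)" .
  qed
  also have "\<dots> = ennreal (\<Sum>n. \<bar>c\<bar> * (1/2) ^ n)"
    by (intro suminf_ennreal2 summable_mult summable_geometric) auto
  finally have "(\<integral>\<^sup>+x. (\<Sum>n. ennreal (2 ^ n * (norm (d n x))\<^sup>2)) \<partial>M) \<noteq> \<infinity>"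
    by (auto simp: top_unique)
  then have "AE x in M. (\<Sum>n. ennreal (2 ^ n * (norm (d n x))\<^sup>2)) \<noteq> \<infinity>"
    by (intro nn_integral_PInf_AE) measurable
  then have lim: "AE x in M. (\<lambda>n. f n x) \<longlonglongrightarrow> g x"
  proof eventually_elim
    case (elim x)
    \<comment> \<open>expand the square of \<open>2 ^ n * y - 1\<close>\<close>
    have le: "y \<le> 2 ^ n * y\<^sup>2 + (1/2) ^ n" for y :: real and n
    proof -
      have *: "(2::real) ^ n * (1/2) ^ n = 1" by (simp add: power_mult_distrib[symmetric])
      have "0 \<le> (1/2) ^ n * (2 ^ n * y - 1)\<^sup>2" by simp
      also have "\<dots> = (2 ^ n * (1/2) ^ n) * (2 ^ n * y\<^sup>2) - 2 * (2 ^ n * (1/2) ^ n) * y + (1/2) ^ n"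
        by (simp add: power2_eq_square algebra_simps)
      also have "\<dots> = 2 ^ n * y\<^sup>2 - 2 * y + (1/2) ^ n" by (simp only: * mult_1_left mult_1_right)
      finally have h: "2 * y \<le> 2 ^ n * y\<^sup>2 + (1/2) ^ n" by simp
      have "0 \<le> 2 ^ n * y\<^sup>2 + (1/2::real) ^ n" by simp
      with h show ?thesis by linarith
    qed
    have "summable (\<lambda>n. 2 ^ n * (norm (d n x))\<^sup>2)"
      using elim by (intro summable_suminf_not_top) auto
    then have "summable (\<lambda>n. 2 ^ n * (norm (d n x))\<^sup>2 + (1/2) ^ n)"
      by (intro summable_add summable_geometric) auto
    then have "summable (\<lambda>n. d n x)"
      by (rule summable_comparison_test'[where N=0]) (rule le)
    then have "(\<lambda>n. f 0 x + (\<Sum>k<n. d k x)) \<longlonglongrightarrow> f 0 x + (\<Sum>k. d k x)"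
      by (intro tendsto_add tendsto_const summable_LIMSEQ)
    moreover have "f 0 x + (\<Sum>k<n. d k x) = f n x" for n
      unfolding d_def by (subst sum_lessThan_telescope) simp
    ultimately have "convergent (\<lambda>n. f n x)" by (auto simp: convergent_def)
    then show ?case unfolding g_def by (simp add: convergent_LIMSEQ_iff)
  qed
  have "(\<integral>\<^sup>+x. ennreal ((norm (f n x - g x))\<^sup>2) \<partial>M) \<le> ennreal (c * (1/4) ^ n)" for n
  proof -
    have "(\<integral>\<^sup>+x. ennreal ((norm (f n x - g x))\<^sup>2) \<partial>M)
        = (\<integral>\<^sup>+x. liminf (\<lambda>m. ennreal ((norm (f m x - f n x))\<^sup>2)) \<partial>M)"
    proof (rule nn_integral_cong_AE, use lim in eventually_elim)
      case (elim x)
      have "(\<lambda>m. ennreal ((norm (f m x - f n x))\<^sup>2)) \<longlonglongrightarrow> ennreal ((norm (g x - f n x))\<^sup>2)"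
        using elim by (intro tendsto_intros) auto
      from lim_imp_Liminf[OF trivial_limit_sequentially this] show ?case
        by (subst norm_minus_commute) (rule sym)
    qed
    also have "\<dots> \<le> liminf (\<lambda>m. \<integral>\<^sup>+x. ennreal ((norm (f m x - f n x))\<^sup>2) \<partial>M)"
      by (rule nn_integral_liminf) measurable
    also have "\<dots> \<le> limsup (\<lambda>m. \<integral>\<^sup>+x. ennreal ((norm (f m x - f n x))\<^sup>2) \<partial>M)"
      by (rule Liminf_le_Limsup) simp
    also have "\<dots> \<le> ennreal (c * (1/4) ^ n)"
      using cauchy by (intro Limsup_bounded) (auto simp: eventually_sequentially)
    finally show ?thesis .
  qed
  then show ?thesis using \<open>g \<in> borel_measurable M\<close> by blast
qed

lemma L2_limit_inner:
  fixes f :: "nat \<Rightarrow> 'a \<Rightarrow> 'b::euclidean_space"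
  assumes [measurable]: "\<And>n. f n \<in> borel_measurable M" "g \<in> borel_measurable M" "w \<in> borel_measurable M"
    and lim: "\<And>n. (\<integral>\<^sup>+x. ennreal ((norm (f n x - g x))\<^sup>2) \<partial>M) \<le> ennreal (e n)" and e: "e \<longlonglongrightarrow> 0" "\<And>n. 0 \<le> e n"
    and w: "integrable M (\<lambda>x. (norm (w x))\<^sup>2)" and f: "\<And>n. integrable M (\<lambda>x. f n x \<bullet> w x)"
  shows "(\<lambda>n. LINT x|M. f n x \<bullet> w x) \<longlonglongrightarrow> (LINT x|M. g x \<bullet> w x)"
proof -
  define W where "W = (LINT x|M. (norm (w x))\<^sup>2)"
  have W: "0 \<le> W" by (simp add: W_def)
  have *: "(\<integral>\<^sup>+x. ennreal (norm ((f n x - g x) \<bullet> w x)) \<partial>M)\<^sup>2 \<le> ennreal (e n * W)" for n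
  proof -
    have "(\<integral>\<^sup>+x. ennreal (norm ((f n x - g x) \<bullet> w x)) \<partial>M)
        \<le> (\<integral>\<^sup>+x. ennreal (norm (f n x - g x)) * ennreal (norm (w x)) \<partial>M)"
      by (intro nn_integral_mono) (simp add: ennreal_mult[symmetric] Cauchy_Schwarz_ineq2)
    then have "(\<integral>\<^sup>+x. ennreal (norm ((f n x - g x) \<bullet> w x)) \<partial>M)\<^sup>2
        \<le> (\<integral>\<^sup>+x. ennreal (norm (f n x - g x)) * ennreal (norm (w x)) \<partial>M)\<^sup>2"
      by (intro power_mono) auto
    also have "\<dots> \<le> (\<integral>\<^sup>+x. (ennreal (norm (f n x - g x)))\<^sup>2 \<partial>M) * (\<integral>\<^sup>+x. (ennreal (norm (w x)))\<^sup>2 \<partial>M)"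
      by (rule Cauchy_Schwarz_nn_integral) measurable
    also have "\<dots> \<le> ennreal (e n) * ennreal W"
      unfolding W_def using lim[of n] w
      by (intro mult_mono) (auto simp: ennreal_power nn_integral_eq_integral)
    finally show ?thesis using e W by (simp add: ennreal_mult)
  qed
  have int: "integrable M (\<lambda>x. (f n x - g x) \<bullet> w x)" for n
  proof (rule integrableI_bounded)
    have "(\<integral>\<^sup>+x. ennreal (norm ((f n x - g x) \<bullet> w x)) \<partial>M)\<^sup>2 < \<infinity>"
      using *[of n] by (rule le_less_trans) simp
    then show "(\<integral>\<^sup>+x. ennreal (norm ((f n x - g x) \<bullet> w x)) \<partial>M) < \<infinity>"
      by (cases "(\<integral>\<^sup>+x. ennreal (norm ((f n x - g x) \<bullet> w x)) \<partial>M) = \<infinity>")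
         (simp_all add: power2_eq_square less_top[symmetric])
  qed measurable
  have "integrable M (\<lambda>x. f 0 x \<bullet> w x - (f 0 x - g x) \<bullet> w x)"
    using f int by (intro Bochner_Integration.integrable_diff)
  then have g: "integrable M (\<lambda>x. g x \<bullet> w x)" by (simp add: inner_diff_left)
  have bound: "((LINT x|M. f n x \<bullet> w x) - (LINT x|M. g x \<bullet> w x))\<^sup>2 \<le> e n * W" for n
  proof -
    have "(LINT x|M. f n x \<bullet> w x) - (LINT x|M. g x \<bullet> w x) = (LINT x|M. (f n x - g x) \<bullet> w x)"
      using f g by (simp add: inner_diff_left)
    then have "ennreal (((LINT x|M. f n x \<bullet> w x) - (LINT x|M. g x \<bullet> w x))\<^sup>2)
        = (ennreal (norm (LINT x|M. (f n x - g x) \<bullet> w x)))\<^sup>2"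
      by (simp add: ennreal_power)
    also have "\<dots> \<le> (\<integral>\<^sup>+x. ennreal (norm ((f n x - g x) \<bullet> w x)) \<partial>M)\<^sup>2"
      using int by (intro power_mono integral_norm_bound_ennreal) auto
    also have "\<dots> \<le> ennreal (e n * W)" by (rule *)
    finally show ?thesis using e W by (simp add: ennreal_le_iff)
  qed
  have "(\<lambda>n. ((LINT x|M. f n x \<bullet> w x) - (LINT x|M. g x \<bullet> w x))\<^sup>2) \<longlonglongrightarrow> 0"
  proof (rule tendsto_sandwich[OF _ _ tendsto_const])
    show "(\<lambda>n. e n * W) \<longlonglongrightarrow> 0" using tendsto_mult_left_zero[OF e(1)] .
  qed (use bound in auto)
  then have "(\<lambda>n. (LINT x|M. f n x \<bullet> w x) - (LINT x|M. g x \<bullet> w x)) \<longlonglongrightarrow> 0"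
    by (simp add: power_tendsto_0_iff)
  then show "(\<lambda>n. LINT x|M. f n x \<bullet> w x) \<longlonglongrightarrow> (LINT x|M. g x \<bullet> w x)"
    by (simp add: LIM_zero_iff)
qed

text \<open>The Riesz representation theorem before completion.  A minimizing sequence of
  \<open>B f f / 2 - l f\<close> is Cauchy by the parallelogram law, and the first variation at an almost
  minimizer is small.\<close>

lemma approximate_Riesz_representation:
  fixes S :: "('a \<Rightarrow> real) set" and B :: "('a \<Rightarrow> real) \<Rightarrow> ('a \<Rightarrow> real) \<Rightarrow> real" and l :: "('a \<Rightarrow> real) \<Rightarrow> real"
  assumes zero: "(\<lambda>x. 0) \<in> S"
    and S_lin: "\<And>f g c. f \<in> S \<Longrightarrow> g \<in> S \<Longrightarrow> (\<lambda>x. f x + c * g x) \<in> S"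
    and B_lin: "\<And>f g h c. f \<in> S \<Longrightarrow> g \<in> S \<Longrightarrow> h \<in> S \<Longrightarrow> B (\<lambda>x. f x + c * g x) h = B f h + c * B g h"
    and B_sym: "\<And>f g. B f g = B g f" and B_pos: "\<And>f. 0 \<le> B f f"
    and l_lin: "\<And>f g c. f \<in> S \<Longrightarrow> g \<in> S \<Longrightarrow> l (\<lambda>x. f x + c * g x) = l f + c * l g"
    and l_bound: "\<And>f. f \<in> S \<Longrightarrow> \<bar>l f\<bar> \<le> C * sqrt (B f f)"
    and e: "\<And>n::nat. 0 < e n"
  shows "\<exists>f. (\<forall>n. f n \<in> S)
     \<and> (\<forall>n m. B (\<lambda>x. f n x + (-1) * f m x) (\<lambda>x. f n x + (-1) * f m x) \<le> 4 * (e n + e m))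
     \<and> (\<forall>n. \<forall>g\<in>S. (B (f n) g - l g)\<^sup>2 \<le> 2 * e n * B g g)"
proof -
  define J where "J f = B f f / 2 - l f" for f
  have expand: "J (\<lambda>x. f x + c * g x) = J f + c * (B f g - l g) + c\<^sup>2 / 2 * B g g"
    if "f \<in> S" "g \<in> S" for f g c
  proof -
    let ?h = "\<lambda>x. f x + c * g x"
    have "B ?h ?h = B f ?h + c * B g ?h"
      using that S_lin by (intro B_lin) auto
    also have "B f ?h = B f f + c * B f g"
      using that by (subst B_sym, subst B_lin) (auto simp: B_sym)
    also have "B g ?h = B f g + c * B g g"
      using that by (subst B_sym, subst B_lin) (auto simp: B_sym)
    finally show ?thesis
      using that by (simp add: J_def l_lin power2_eq_square field_simps)
  qed
  have lower: "- (C\<^sup>2 / 2) \<le> J f" if "f \<in> S" for f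
  proof -
    have "0 \<le> (sqrt (B f f) - C)\<^sup>2 / 2" by simp
    also have "\<dots> = B f f / 2 - C * sqrt (B f f) + C\<^sup>2 / 2"
      using B_pos[of f] by (simp add: power2_diff field_simps)
    finally show ?thesis
      using l_bound[OF that] unfolding J_def by linarith
  qed
  define m where "m = (INF f\<in>S. J f)"
  have bdd: "bdd_below (J ` S)" using lower by (intro bdd_belowI2)
  have m: "m \<le> J f" if "f \<in> S" for f
    unfolding m_def using bdd that by (rule cINF_lower)
  have "\<exists>f\<in>S. J f < m + e n" for n
    using cINF_less_iff[of S J "m + e n"] bdd zero e[of n] unfolding m_def by auto
  then obtain f where f: "\<And>n. f n \<in> S" "\<And>n. J (f n) < m + e n" by metis
  have "B (\<lambda>x. f n x + (-1) * f k x) (\<lambda>x. f n x + (-1) * f k x) \<le> 4 * (e n + e k)" for n k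
  proof -
    define g where "g x = f n x + (-1) * f k x" for x
    have g: "g \<in> S" unfolding g_def using f S_lin by blast
    have "f n = (\<lambda>x. f k x + 1 * g x)" by (simp add: g_def)
    then have 1: "J (f n) = J (f k) + (B (f k) g - l g) + B g g / 2"
      using expand[OF f(1) g, of k 1] by simp
    \<comment> \<open>the midpoint of two almost minimizers is no better than the infimum\<close>
    have "m \<le> J (\<lambda>x. f k x + (1/2) * g x)"
      using m S_lin[OF f(1) g] by blast
    also have "\<dots> = J (f k) + (B (f k) g - l g) / 2 + B g g / 8"
      using expand[OF f(1) g, of k "1/2"] by (simp add: power2_eq_square)
    finally have "B g g \<le> 4 * (e n + e k)" using 1 f(2)[of n] f(2)[of k] by argo
    then show ?thesis by (simp add: g_def[abs_def])
  qed
  moreover have "(B (f n) g - l g)\<^sup>2 \<le> 2 * e n * B g g" if g: "g \<in> S" for n g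
  proof -
    define r where "r = B (f n) g - l g"
    have q: "0 \<le> e n + t * r + t\<^sup>2 / 2 * B g g" for t
      using m[OF S_lin[OF f(1) g], of n t] f(2)[of n] expand[OF f(1) g, of n t]
      by (simp add: r_def)
    show ?thesis
    proof (cases "B g g = 0")
      case True
      have "r = 0"
      proof (rule ccontr)
        assume "r \<noteq> 0"
        \<comment> \<open>the functional along \<open>g\<close> would be affine and not constant, hence unbounded below\<close>
        then show False using q[of "- (e n + 1) / r"] True by simp
      qed
      then show ?thesis using True by (simp add: r_def)
    next
      case False
      then have "B g g > 0" using B_pos[of g] by simp
      moreover have "0 \<le> e n - r\<^sup>2 / (2 * B g g)"
        using q[of "- r / B g g"] False by (simp add: power2_eq_square field_simps)
      ultimately show ?thesis
        by (simp add: r_def field_simps)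
    qed
  qed
  ultimately show ?thesis using f(1) by blast
qed

section \<open>Weak solutions of the Poisson equation\<close>

lemma square_integrable_near:
  fixes f g :: "'a \<Rightarrow> 'b::euclidean_space"
  assumes [measurable]: "f \<in> borel_measurable M" "g \<in> borel_measurable M"
    and f: "integrable M (\<lambda>x. (norm (f x))\<^sup>2)"
    and fg: "(\<integral>\<^sup>+x. ennreal ((norm (f x - g x))\<^sup>2) \<partial>M) \<le> ennreal e"
  shows "integrable M (\<lambda>x. (norm (g x))\<^sup>2)" and "integrable M (\<lambda>x. (norm (f x - g x))\<^sup>2)"
proof -
  show d: "integrable M (\<lambda>x. (norm (f x - g x))\<^sup>2)"
    by (rule integrableI_bounded) (use le_less_trans[OF fg] in auto)
  show "integrable M (\<lambda>x. (norm (g x))\<^sup>2)"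
  proof (rule Bochner_Integration.integrable_bound)
    show "integrable M (\<lambda>x. 2 * (norm (f x))\<^sup>2 + 2 * (norm (f x - g x))\<^sup>2)"
      using f d by simp
    show "AE x in M. norm ((norm (g x))\<^sup>2) \<le> norm (2 * (norm (f x))\<^sup>2 + 2 * (norm (f x - g x))\<^sup>2)"
    proof (intro AE_I2)
      fix x
      have "norm (g x) \<le> norm (f x) + norm (f x - g x)"
        using norm_triangle_ineq4[of "f x" "f x - g x"] by simp
      then have "(norm (g x))\<^sup>2 \<le> (norm (f x) + norm (f x - g x))\<^sup>2"
        by (rule power_mono) simp
      also have "\<dots> \<le> 2 * (norm (f x))\<^sup>2 + 2 * (norm (f x - g x))\<^sup>2"
        using sum_squares_bound[of "norm (f x)" "norm (f x - g x)"] by (simp add: power2_sum)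
      finally show "norm ((norm (g x))\<^sup>2) \<le> norm (2 * (norm (f x))\<^sup>2 + 2 * (norm (f x - g x))\<^sup>2)"
        by simp
    qed
  qed measurable
qed

lemma square_integrable_imp_set_integrable:
  fixes g :: "'a::euclidean_space \<Rightarrow> 'b::euclidean_space"
  assumes g[measurable]: "g \<in> borel_measurable borel" and "integrable lborel (\<lambda>x. (norm (g x))\<^sup>2)"
    and S[measurable]: "S \<in> sets borel" and "bounded S"
  shows "integrable lborel (\<lambda>x. indicator S x *\<^sub>R g x)" and "set_integrable lebesgue S g"
proof -
  show 1: "integrable lborel (\<lambda>x. indicator S x *\<^sub>R g x)"
  proof (rule Bochner_Integration.integrable_bound)
    show "integrable lborel (\<lambda>x. indicator S x + (norm (g x))\<^sup>2 :: real)"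
      using assms emeasure_bounded_finite[OF \<open>bounded S\<close>]
      by (intro Bochner_Integration.integrable_add) (auto simp: integrable_indicator_iff)
    show "AE x in lborel. norm (indicator S x *\<^sub>R g x) \<le> norm (indicator S x + (norm (g x))\<^sup>2 :: real)"
    proof (intro AE_I2)
      fix x
      have "0 \<le> (norm (g x) - 1)\<^sup>2 + 1 + (norm (g x))\<^sup>2" by simp
      then have "norm (g x) \<le> 1 + (norm (g x))\<^sup>2" by (simp add: power2_diff)
      then show "norm (indicator S x *\<^sub>R g x) \<le> norm (indicator S x + (norm (g x))\<^sup>2 :: real)"
        by (auto simp: indicator_def)
    qed
  qed measurable
  then show "set_integrable lebesgue S g"
    unfolding set_integrable_def by (subst integrable_completion) auto
qed

lemma square_integrable_imp_Lp2:
  fixes g :: "real^2 \<Rightarrow> 'b::euclidean_space"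
  assumes [measurable]: "g \<in> borel_measurable borel" "\<Omega> \<in> sets borel"
    and int: "integrable lborel (\<lambda>x. (norm (g x))\<^sup>2)"
  shows "g \<in> Lp 2 \<Omega>"
proof -
  have eq: "norm (g x) powr 2 = (norm (g x))\<^sup>2" for x
    by (cases "g x = 0") (auto simp: powr_numeral)
  have "integrable lebesgue (\<lambda>x. (norm (g x))\<^sup>2)"
    using int by (subst integrable_completion) auto
  then have "set_integrable lebesgue \<Omega> (\<lambda>x. (norm (g x))\<^sup>2)"
    unfolding set_integrable_def by (intro integrable_mult_indicator) auto
  moreover have "(\<lambda>x. indicator \<Omega> x *\<^sub>R g x) \<in> borel_measurable lebesgue"
    by (intro measurable_completion) measurable
  ultimately show ?thesis
    by (simp add: Lp_def set_borel_measurable_def eq)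
qed

lemma linear_perp: "linear perp"
  by (rule linearI) (simp_all add: perp_def vec_eq_iff forall_2)

lemma perp_inner: "perp a \<bullet> b = - (a \<bullet> perp b)"
  by (simp_all add: perp_def inner_vec_def sum_2)

lemma continuous_on_perp [continuous_intros]:
  "continuous_on S f \<Longrightarrow> continuous_on S (\<lambda>x. perp (f x))"
  by (rule continuous_on_compose2[OF linear_continuous_on[OF linear_perp[unfolded linear_conv_bounded_linear], of UNIV]]) auto

lemma perp_0 [simp]: "perp 0 = 0"
  by (rule linear_0[OF linear_perp])

lemma integrable_grad_inner:
  assumes "\<phi> \<in> C1_c \<Omega>" "continuous_on UNIV w"
  shows "integrable lborel (\<lambda>x. grad \<phi> x \<bullet> w x)"
proof -
  obtain K where K: "compact K" "\<forall>z. z \<notin> K \<longrightarrow> \<phi> z = 0 \<and> grad \<phi> z = 0"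
    using C1_cD(4)[OF assms(1)] by blast
  show ?thesis
    using C1_cD(3)[OF assms(1)] assms(2) K(2)
    by (intro integrable_continuous_compact_support[OF _ K(1)] continuous_intros) auto
qed

text \<open>A gradient is orthogonal to a rotated gradient: the integrand is the Jacobian determinant of the
  pair of functions, whose two products have equal integrals.\<close>

lemma integral_grad_perp_grad_eq_0:
  assumes "\<phi> \<in> C1_c \<Omega>" "\<psi> \<in> C1_c \<Omega>'"
  shows "(LINT x|lborel. grad \<phi> x \<bullet> perp (grad \<psi> x)) = 0"
proof -
  let ?D = "\<lambda>i j. \<lambda>x. (grad \<phi> x \<bullet> axis i 1) * (grad \<psi> x \<bullet> axis j 1)"
  have pt: "a \<bullet> perp b = (a \<bullet> axis 1 1) * (b \<bullet> axis 2 1) - (a \<bullet> axis 2 1) * (b \<bullet> axis 1 1)" for a b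
    by (simp add: inner_axis) (simp add: inner_vec_def sum_2 perp_def)
  have int: "integrable lborel (?D i j)" for i j
  proof -
    have "integrable lborel (\<lambda>x. grad \<phi> x \<bullet> ((grad \<psi> x \<bullet> axis j 1) *\<^sub>R axis i 1))"
      by (intro integrable_grad_inner[OF assms(1)] continuous_intros C1_cD(3)[OF assms(2)])
    then show ?thesis by (simp add: mult.commute)
  qed
  have "(LINT x|lborel. grad \<phi> x \<bullet> perp (grad \<psi> x)) = (LINT x|lborel. ?D 1 2 x - ?D 2 1 x)"
    by (simp only: pt)
  also have "\<dots> = (LINT x|lborel. ?D 1 2 x) - (LINT x|lborel. ?D 2 1 x)"
    using int by simp
  also have "\<dots> = 0"
    using integral_grad_grad_commute[OF assms, of "axis 1 1" "axis 2 1"] by simp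
  finally show ?thesis .
qed

text \<open>The solution is the limit of a minimizing sequence for half the Dirichlet energy minus the
  pairing with the density.  Besides the weak equation, the limit inherits from its approximants that its gradient is orthogonal to every
  rotated gradient.\<close>

lemma weak_Poisson:
  fixes \<rho> :: "real^2 \<Rightarrow> real"
  assumes \<Omega>: "open \<Omega>" "bounded \<Omega>" and p: "p > 1" and \<rho>: "\<rho> \<in> Lp p \<Omega>" "\<rho> \<in> L1_loc \<Omega>"
  shows "\<exists>u G. u \<in> H1_0 \<Omega> \<and> has_weak_gradient \<Omega> u G
    \<and> (\<forall>S\<in>sets borel. bounded S \<longrightarrow> set_integrable lebesgue S G)
    \<and> (\<forall>\<zeta>\<in>C1_c \<Omega>. (LINT x:\<Omega>|lebesgue. grad \<zeta> x \<bullet> G x) = (LINT x:\<Omega>|lebesgue. \<rho> x * \<zeta> x))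
    \<and> (\<forall>\<zeta>\<in>C1_c \<Omega>. (LINT x:\<Omega>|lebesgue. perp (grad \<zeta> x) \<bullet> G x) = 0)"
proof -
  define l where "l \<phi> = (LINT x:\<Omega>|lebesgue. \<rho> x * \<phi> x)" for \<phi>
  define B where "B \<phi> \<psi> = (LINT x|lborel. grad \<phi> x \<bullet> grad \<psi> x)" for \<phi> \<psi> :: "real^2 \<Rightarrow> real"
  define e :: "nat \<Rightarrow> real" where "e n = (1/4) ^ n / 8" for n
  define c where "c = 1 + measure lborel \<Omega>"
  have [measurable]: "\<Omega> \<in> sets borel" using \<Omega> by auto
  have c: "c > 0" unfolding c_def by (simp add: add_pos_nonneg)
  have B_norm: "B \<phi> \<phi> = (LINT x|lborel. (norm (grad \<phi> x))\<^sup>2)" for \<phi>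
    by (simp add: B_def power2_norm_eq_inner)
  have B_lin: "B (\<lambda>x. f x + c * g x) h = B f h + c * B g h"
    if "f \<in> C1_c \<Omega>" "g \<in> C1_c \<Omega>" "h \<in> C1_c \<Omega>" for f g h c
    using integrable_grad_inner[OF that(1) C1_cD(3)[OF that(3)]]
      integrable_grad_inner[OF that(2) C1_cD(3)[OF that(3)]]
    by (simp add: B_def C1_c_lincomb(2)[OF that(1,2)] inner_add_left)
  have l_lin: "l (\<lambda>x. f x + c * g x) = l f + c * l g" if "f \<in> C1_c \<Omega>" "g \<in> C1_c \<Omega>" for f g c
  proof -
    have "l (\<lambda>x. f x + c * g x) = (LINT x:\<Omega>|lebesgue. \<rho> x * f x + c * (\<rho> x * g x))"
      by (simp add: l_def algebra_simps)
    also have "\<dots> = l f + c * l g"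
      unfolding l_def using L1_loc_test_integrable_real[OF \<rho>(2)] that by (subst set_integral_add(2)) auto
    finally show ?thesis .
  qed
  obtain C where C: "\<And>\<phi>. \<phi> \<in> C1_c \<Omega> \<Longrightarrow> \<bar>l \<phi>\<bar> \<le> C * sqrt (B \<phi> \<phi>)"
    using Lp_bounded_functional[OF \<Omega> p \<rho>] unfolding l_def B_norm by blast
  \<comment> \<open>the rate \<open>e\<close> makes the energy of \<open>f m - f n\<close> at most \<open>(1/4) ^ n\<close> for \<open>n \<le> m\<close>\<close>
  have "\<exists>f. (\<forall>n. f n \<in> C1_c \<Omega>)
     \<and> (\<forall>n m. B (\<lambda>x. f n x + (-1) * f m x) (\<lambda>x. f n x + (-1) * f m x) \<le> 4 * (e n + e m))
     \<and> (\<forall>n. \<forall>g\<in>C1_c \<Omega>. (B (f n) g - l g)\<^sup>2 \<le> 2 * e n * B g g)"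
  proof (rule approximate_Riesz_representation)
    show "0 \<le> B f f" for f by (simp add: B_norm)
    show "B f g = B g f" for f g by (simp add: B_def inner_commute)
    show "0 < e n" for n by (simp add: e_def)
  qed (use C1_c_zero(1) C1_c_lincomb(1) B_lin l_lin C in auto)
  then obtain f where f: "\<And>n. f n \<in> C1_c \<Omega>"
    and f_Cauchy: "\<And>n m. B (\<lambda>x. f n x + (-1) * f m x) (\<lambda>x. f n x + (-1) * f m x) \<le> 4 * (e n + e m)"
    and f_crit: "\<And>n g. g \<in> C1_c \<Omega> \<Longrightarrow> (B (f n) g - l g)\<^sup>2 \<le> 2 * e n * B g g"
    by blast
  \<comment> \<open>pairing a function with its gradient turns the \<open>H\<^sup>1\<close> norm into an \<open>L\<^sup>2\<close> norm\<close>
  define F where "F n x = (f n x, grad (f n) x)" for n x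
  have F_meas [measurable]: "F n \<in> borel_measurable borel" for n
    using C1_c_measurable[OF f[of n]] unfolding F_def[abs_def] by measurable
  have F_cont: "continuous_on UNIV (F n)" for n
    unfolding F_def[abs_def] by (intro continuous_intros C1_cD[OF f])
  have F_Cauchy: "(\<integral>\<^sup>+x. ennreal ((norm (F m x - F n x))\<^sup>2) \<partial>lborel) \<le> ennreal (c * (1/4) ^ n)"
    if "n \<le> m" for n m
  proof -
    define \<delta> where "\<delta> x = f m x + (-1) * f n x" for x
    have \<delta>: "\<delta> \<in> C1_c \<Omega>" "grad \<delta> = (\<lambda>x. grad (f m) x + (-1) *\<^sub>R grad (f n) x)"
      unfolding \<delta>_def using C1_c_lincomb[OF f f] by blast+
    have int: "integrable lborel (\<lambda>x. (\<delta> x)\<^sup>2)" "integrable lborel (\<lambda>x. (norm (grad \<delta> x))\<^sup>2)"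
      using C1_c_integrable_pow[OF \<delta>(1), of 1] by (simp_all add: numeral_2_eq_2)
    have "B \<delta> \<delta> \<le> 4 * (e m + e n)"
      using f_Cauchy[of m n] unfolding \<delta>_def[abs_def] .
    moreover have "e m \<le> e n"
      unfolding e_def using that by (intro divide_right_mono power_decreasing) auto
    ultimately have "B \<delta> \<delta> \<le> 8 * e n" by argo
    then have D: "B \<delta> \<delta> \<le> (1/4) ^ n" by (simp add: e_def)
    \<comment> \<open>Poincare's inequality, whose constant enters into \<open>c\<close>\<close>
    have "(LINT x|lborel. (\<delta> x)\<^sup>2) \<le> measure lborel \<Omega> * B \<delta> \<delta>"
      using Sobolev_even_power_real[OF \<delta>(1), of 1] \<Omega> unfolding B_norm by simp
    then have le: "(LINT x|lborel. (\<delta> x)\<^sup>2) + B \<delta> \<delta> \<le> c * (1/4) ^ n"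
      using mult_left_mono[OF D, of c] c by (simp add: c_def algebra_simps)
    have "(\<integral>\<^sup>+x. ennreal ((norm (F m x - F n x))\<^sup>2) \<partial>lborel)
        = (\<integral>\<^sup>+x. ennreal ((\<delta> x)\<^sup>2 + (norm (grad \<delta> x))\<^sup>2) \<partial>lborel)"
      by (simp add: F_def norm_Pair \<delta>(2) \<delta>_def)
    also have "\<dots> = ennreal (LINT x|lborel. (\<delta> x)\<^sup>2 + (norm (grad \<delta> x))\<^sup>2)"
      using int by (intro nn_integral_eq_integral) auto
    also have "(LINT x|lborel. (\<delta> x)\<^sup>2 + (norm (grad \<delta> x))\<^sup>2) = (LINT x|lborel. (\<delta> x)\<^sup>2) + B \<delta> \<delta>"
      unfolding B_norm using int by simp
    finally show ?thesis using le by (simp add: ennreal_leI)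
  qed
  obtain g where g0: "g \<in> borel_measurable lborel"
    and g_lim: "\<And>n. (\<integral>\<^sup>+x. ennreal ((norm (F n x - g x))\<^sup>2) \<partial>lborel) \<le> ennreal (c * (1/4) ^ n)"
    using rapidly_Cauchy_L2_limit[of F lborel c] F_Cauchy by auto
  have g[measurable]: "g \<in> borel_measurable borel" using g0 by simp
  define u where "u x = fst (g x)" for x
  define G where "G x = snd (g x)" for x
  have uG[measurable]: "u \<in> borel_measurable borel" "G \<in> borel_measurable borel"
    unfolding u_def[abs_def] G_def[abs_def]
    by (rule measurable_compose[OF g], rule borel_measurable_continuous_onI, intro continuous_intros)+
  have g_eq: "g x = (u x, G x)" for x by (simp add: u_def G_def)
  have F_sq: "integrable lborel (\<lambda>x. (norm (F n x))\<^sup>2)" for n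
    using C1_c_integrable_pow[OF f[of n], of 1] by (simp add: F_def norm_Pair numeral_2_eq_2)
  have g_sq: "integrable lborel (\<lambda>x. (norm (g x))\<^sup>2)"
    and Fg_sq: "integrable lborel (\<lambda>x. (norm (F n x - g x))\<^sup>2)" for n
    using square_integrable_near[OF _ _ F_sq g_lim] by auto
  have u_sq: "integrable lborel (\<lambda>x. (norm (u x))\<^sup>2)" and G_sq: "integrable lborel (\<lambda>x. (norm (G x))\<^sup>2)"
    by (rule Bochner_Integration.integrable_bound[OF g_sq]; simp add: g_eq norm_Pair)+
  \<comment> \<open>every identity for the limit is the limit of an identity for test functions, read off by pairing
    with a suitable continuous \<open>w\<close>\<close>
  have test: "(LINT x|lborel. g x \<bullet> w x) = L"
    if w: "continuous_on UNIV w" "compact K" "\<And>x. x \<notin> K \<Longrightarrow> w x = 0"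
      and L: "(\<lambda>n. LINT x|lborel. F n x \<bullet> w x) \<longlonglongrightarrow> L" for w K L
  proof -
    have [measurable]: "w \<in> borel_measurable borel"
      using w by (simp add: borel_measurable_continuous_onI)
    have "(\<lambda>n. LINT x|lborel. F n x \<bullet> w x) \<longlonglongrightarrow> (LINT x|lborel. g x \<bullet> w x)"
    proof (rule L2_limit_inner[where e="\<lambda>n. c * (1/4) ^ n"])
      show "(\<lambda>n. c * (1/4) ^ n) \<longlonglongrightarrow> 0"
        by (intro tendsto_mult_right_zero LIMSEQ_power_zero) simp
      show "integrable lborel (\<lambda>x. (norm (w x))\<^sup>2)" "integrable lborel (\<lambda>x. F n x \<bullet> w x)" for n
        using w F_cont by (auto intro!: integrable_continuous_compact_support[OF _ w(2)] continuous_intros)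
    qed (use g_lim c in auto)
    then show ?thesis using L LIMSEQ_unique by blast
  qed
  have test_G: "(LINT x:\<Omega>|lebesgue. w x \<bullet> G x) = L"
    if w: "continuous_on UNIV w" "compact K" "K \<subseteq> \<Omega>" "\<And>x. x \<notin> K \<Longrightarrow> w x = 0"
      and L: "(\<lambda>n. LINT x|lborel. grad (f n) x \<bullet> w x) \<longlonglongrightarrow> L" for w K L
  proof -
    have [measurable]: "w \<in> borel_measurable borel"
      using w by (simp add: borel_measurable_continuous_onI)
    have "(LINT x|lborel. g x \<bullet> (0, w x)) = L"
      using w(1,4) L by (intro test[OF _ w(2)] continuous_intros) (auto simp: F_def inner_Pair zero_prod_def)
    then have "(LINT x|lborel. w x \<bullet> G x) = L"
      by (simp add: g_eq inner_Pair inner_commute)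
    moreover have "w x = 0" if "x \<notin> \<Omega>" for x
      using w(3,4) that by blast
    then have "(LINT x:\<Omega>|lebesgue. w x \<bullet> G x) = (LINT x|lborel. w x \<bullet> G x)"
      by (intro set_integral_lebesgue_eq_lborel) auto
    ultimately show ?thesis by simp
  qed
  have int_u: "set_integrable lebesgue S u" and int_G: "set_integrable lebesgue S G"
    if "S \<in> sets borel" "bounded S" for S
    using square_integrable_imp_set_integrable(2)[OF uG(1) u_sq that]
      square_integrable_imp_set_integrable(2)[OF uG(2) G_sq that] by auto
  have weak: "has_weak_gradient \<Omega> u G"
    unfolding has_weak_gradient_def
  proof (intro conjI ballI)
    show "u \<in> L1_loc \<Omega>" "G \<in> L1_loc \<Omega>"
      using int_u int_G by (auto simp: L1_loc_def compact_imp_bounded borel_compact)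
    fix \<phi> assume \<phi>: "\<phi> \<in> C1_c \<Omega>"
    note [measurable] = C1_c_measurable[OF \<phi>]
    obtain K where K: "compact K" "K \<subseteq> \<Omega>" "\<forall>x. x \<notin> K \<longrightarrow> \<phi> x = 0 \<and> grad \<phi> x = 0"
      using C1_cD(4)[OF \<phi>] by blast
    obtain b where b: "\<And>x. \<bar>\<phi> x\<bar> \<le> b" "\<And>x. norm (grad \<phi> x) \<le> b"
      using C1_c_bounded[OF \<phi>] by blast
    have K_meas: "K \<in> sets borel" "bounded K" using K(1) by (auto simp: borel_compact compact_imp_bounded)
    have intK: "integrable lborel (\<lambda>x. b *\<^sub>R norm (indicator K x *\<^sub>R u x))"
      "integrable lborel (\<lambda>x. b *\<^sub>R norm (indicator K x *\<^sub>R G x))"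
      by (intro integrable_scaleR_right integrable_norm
          square_integrable_imp_set_integrable(1)[OF uG(1) u_sq K_meas]
          square_integrable_imp_set_integrable(1)[OF uG(2) G_sq K_meas])+
    have b0: "b \<ge> 0" using b(1)[of 0] by linarith
    have le: "norm (u x *\<^sub>R grad \<phi> x) \<le> norm (b *\<^sub>R norm (indicator K x *\<^sub>R u x))"
      "norm (\<phi> x *\<^sub>R G x) \<le> norm (b *\<^sub>R norm (indicator K x *\<^sub>R G x))" for x
    proof -
      show "norm (u x *\<^sub>R grad \<phi> x) \<le> norm (b *\<^sub>R norm (indicator K x *\<^sub>R u x))"
        using K(3) b0 mult_right_mono[OF b(2)[of x], of "\<bar>u x\<bar>"] by (cases "x \<in> K") (auto simp: mult.commute)
      show "norm (\<phi> x *\<^sub>R G x) \<le> norm (b *\<^sub>R norm (indicator K x *\<^sub>R G x))"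
        using K(3) b0 mult_right_mono[OF b(1)[of x], of "norm (G x)"] by (cases "x \<in> K") auto
    qed
    have int: "integrable lborel (\<lambda>x. u x *\<^sub>R grad \<phi> x)" "integrable lborel (\<lambda>x. \<phi> x *\<^sub>R G x)"
      by (rule Bochner_Integration.integrable_bound[OF intK(1)], measurable, intro AE_I2 le)
         (rule Bochner_Integration.integrable_bound[OF intK(2)], measurable, intro AE_I2 le)
    let ?V = "(LINT x|lborel. u x *\<^sub>R grad \<phi> x + \<phi> x *\<^sub>R G x)"
    have "?V \<bullet> a = 0" for a
    proof -
      have "?V \<bullet> a = (LINT x|lborel. (u x *\<^sub>R grad \<phi> x + \<phi> x *\<^sub>R G x) \<bullet> a)"
        using int by (intro integral_inner_left[symmetric]) auto
      also have "\<dots> = (LINT x|lborel. g x \<bullet> (grad \<phi> x \<bullet> a, \<phi> x *\<^sub>R a))"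
        by (simp add: g_eq inner_Pair inner_add_left)
      also have "\<dots> = 0"
      proof (rule test[OF _ K(1)])
        have "(LINT x|lborel. F n x \<bullet> (grad \<phi> x \<bullet> a, \<phi> x *\<^sub>R a)) = 0" for n
        proof -
          have i: "integrable lborel (\<lambda>x. f n x * (grad \<phi> x \<bullet> a))" "integrable lborel (\<lambda>x. (grad (f n) x \<bullet> a) * \<phi> x)"
            using K(3) C1_cD(2,3)[OF f[of n]] C1_cD(2,3)[OF \<phi>]
            by (auto intro!: integrable_continuous_compact_support[OF _ K(1)] continuous_intros)
          have "(LINT x|lborel. F n x \<bullet> (grad \<phi> x \<bullet> a, \<phi> x *\<^sub>R a))
              = (LINT x|lborel. f n x * (grad \<phi> x \<bullet> a) + (grad (f n) x \<bullet> a) * \<phi> x)"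
            by (simp add: F_def inner_Pair mult.commute)
          also have "\<dots> = 0"
            using i by (simp add: C1_c_parts[OF f \<phi>])
          finally show ?thesis .
        qed
        then show "(\<lambda>n. LINT x|lborel. F n x \<bullet> (grad \<phi> x \<bullet> a, \<phi> x *\<^sub>R a)) \<longlonglongrightarrow> 0" by simp
        show "continuous_on UNIV (\<lambda>x. (grad \<phi> x \<bullet> a, \<phi> x *\<^sub>R a))"
          by (intro continuous_intros C1_cD[OF \<phi>])
      qed (use K(3) in \<open>auto simp: zero_prod_def\<close>)
      finally show ?thesis .
    qed
    from this[of ?V] have "?V = 0" by simp
    then have "(LINT x|lborel. u x *\<^sub>R grad \<phi> x) = - (LINT x|lborel. \<phi> x *\<^sub>R G x)"
      using int by (simp add: eq_neg_iff_add_eq_0)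
    moreover have "\<phi> x = 0 \<and> grad \<phi> x = 0" if "x \<notin> \<Omega>" for x
      using K(2,3) that by blast
    then have "(LINT x:\<Omega>|lebesgue. u x *\<^sub>R grad \<phi> x) = (LINT x|lborel. u x *\<^sub>R grad \<phi> x)"
      "(LINT x:\<Omega>|lebesgue. \<phi> x *\<^sub>R G x) = (LINT x|lborel. \<phi> x *\<^sub>R G x)"
      by (auto intro!: set_integral_lebesgue_eq_lborel)
    ultimately show "(LINT x:\<Omega>|lebesgue. u x *\<^sub>R grad \<phi> x) = - (LINT x:\<Omega>|lebesgue. \<phi> x *\<^sub>R G x)"
      by simp
  qed
  have H1: "u \<in> H1_0 \<Omega>"
  proof -
    have bnd: "(LINT x:\<Omega>|lebesgue. (f n x - u x)\<^sup>2 + (norm (grad (f n) x - G x))\<^sup>2) \<le> c * (1/4) ^ n"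
      "0 \<le> (LINT x:\<Omega>|lebesgue. (f n x - u x)\<^sup>2 + (norm (grad (f n) x - G x))\<^sup>2)" for n
    proof -
      let ?I = "LINT x:\<Omega>|lebesgue. (f n x - u x)\<^sup>2 + (norm (grad (f n) x - G x))\<^sup>2"
      have "?I = (LINT x|lebesgue. indicator \<Omega> x * (norm (F n x - g x))\<^sup>2)"
        by (simp add: set_lebesgue_integral_def F_def g_eq norm_Pair)
      also have I: "\<dots> = (LINT x|lborel. indicator \<Omega> x * (norm (F n x - g x))\<^sup>2)"
        by (intro integral_completion) measurable
      finally have I: "?I = (LINT x|lborel. indicator \<Omega> x * (norm (F n x - g x))\<^sup>2)" .
      also have "\<dots> \<le> (LINT x|lborel. (norm (F n x - g x))\<^sup>2)"
        using Fg_sq[of n] integrable_mult_indicator[OF _ Fg_sq[of n], of \<Omega>]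
        by (intro integral_mono) (auto simp: indicator_def)
      also have "ennreal \<dots> \<le> ennreal (c * (1/4) ^ n)"
        using g_lim[of n] Fg_sq[of n] by (simp add: nn_integral_eq_integral)
      then have "(LINT x|lborel. (norm (F n x - g x))\<^sup>2) \<le> c * (1/4) ^ n"
        using c by (simp add: ennreal_le_iff)
      finally show "?I \<le> c * (1/4) ^ n" .
      show "0 \<le> ?I" unfolding I by simp
    qed
    have lim: "(\<lambda>n. c * (1/4) ^ n) \<longlonglongrightarrow> 0"
      by (intro tendsto_mult_right_zero LIMSEQ_power_zero) simp
    have "(\<lambda>n. LINT x:\<Omega>|lebesgue. (f n x - u x)\<^sup>2 + (norm (grad (f n) x - G x))\<^sup>2) \<longlonglongrightarrow> 0"
      by (rule tendsto_sandwich[OF _ _ tendsto_const lim]) (use bnd in auto)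
    from tendsto_real_sqrt[OF this]
    have "(\<lambda>n. sqrt (LINT x:\<Omega>|lebesgue. (f n x - u x)\<^sup>2 + (norm (grad (f n) x - G x))\<^sup>2)) \<longlonglongrightarrow> 0"
      by simp
    moreover have "u \<in> Lp 2 \<Omega>" "G \<in> Lp 2 \<Omega>"
      by (intro square_integrable_imp_Lp2 uG u_sq G_sq \<open>\<Omega> \<in> sets borel\<close>)+
    ultimately show ?thesis
      unfolding H1_0_def mem_Collect_eq using weak f
      by (intro exI[of _ G] exI[of _ f] conjI allI)
  qed
  have Euler: "(LINT x:\<Omega>|lebesgue. grad \<zeta> x \<bullet> G x) = (LINT x:\<Omega>|lebesgue. \<rho> x * \<zeta> x)"
    and curl: "(LINT x:\<Omega>|lebesgue. perp (grad \<zeta> x) \<bullet> G x) = 0" if \<zeta>: "\<zeta> \<in> C1_c \<Omega>" for \<zeta>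
  proof -
    obtain K where K: "compact K" "K \<subseteq> \<Omega>" "\<forall>x. x \<notin> K \<longrightarrow> \<zeta> x = 0 \<and> grad \<zeta> x = 0"
      using C1_cD(4)[OF \<zeta>] by blast
    have lim: "(\<lambda>n. 2 * e n * B \<zeta> \<zeta>) \<longlonglongrightarrow> 0"
      unfolding e_def by (intro tendsto_mult_left_zero tendsto_mult_right_zero tendsto_divide_zero LIMSEQ_power_zero) simp
    have "(\<lambda>n. (B (f n) \<zeta> - l \<zeta>)\<^sup>2) \<longlonglongrightarrow> 0"
      by (rule tendsto_sandwich[OF _ _ tendsto_const lim]) (use f_crit[OF \<zeta>] in auto)
    then have "(\<lambda>n. B (f n) \<zeta>) \<longlonglongrightarrow> l \<zeta>"
      by (simp add: power_tendsto_0_iff LIM_zero_iff)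
    then show "(LINT x:\<Omega>|lebesgue. grad \<zeta> x \<bullet> G x) = (LINT x:\<Omega>|lebesgue. \<rho> x * \<zeta> x)"
      unfolding B_def l_def by (rule test_G[OF C1_cD(3)[OF \<zeta>] K(1,2), rotated]) (use K(3) in auto)
    show "(LINT x:\<Omega>|lebesgue. perp (grad \<zeta> x) \<bullet> G x) = 0"
      using K(3) by (intro test_G[OF _ K(1,2)] continuous_intros C1_cD(3)[OF \<zeta>])
        (auto simp: integral_grad_perp_grad_eq_0[OF f \<zeta>])
  qed
  show ?thesis
    by (intro exI[of _ u] exI[of _ G] conjI ballI impI H1 weak int_G Euler curl)
qed

section \<open>The Helmholtz decomposition\<close>

theorem theorem5p2:
  fixes \<Omega> :: "(real^2) set" and v :: "real^2 \<Rightarrow> real^2"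
    and \<rho> \<omega> :: "real^2 \<Rightarrow> real" and p :: real
  assumes "region \<Omega>" and "bounded \<Omega>" and "lipschitz_loop_boundary \<Omega>"
    and "p > 1"
    and "has_weak_div \<Omega> v \<rho>" and "\<rho> \<in> Lp p \<Omega>"
    and "has_weak_curl \<Omega> v \<omega>" and "\<omega> \<in> Lp p \<Omega>"
  shows "(v \<in> L1_loc \<Omega> \<longrightarrow>
            (\<exists>\<phi>\<^sub>0\<in>H1_0 \<Omega>. \<exists>\<psi>\<^sub>0\<in>H1_0 \<Omega>. \<exists>h\<in>L1_loc \<Omega>.
               harmonic_field \<Omega> h \<and> has_decomposition \<Omega> v \<psi>\<^sub>0 \<phi>\<^sub>0 h))
       \<and> (v \<in> L1 \<Omega> \<longrightarrow>
            (\<exists>\<phi>\<^sub>0\<in>H1_0 \<Omega>. \<exists>\<psi>\<^sub>0\<in>H1_0 \<Omega>. \<exists>h\<in>L1 \<Omega>.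
               harmonic_field \<Omega> h \<and> has_decomposition \<Omega> v \<psi>\<^sub>0 \<phi>\<^sub>0 h))"
proof -
  have \<Omega>: "open \<Omega>" "bounded \<Omega>" "\<Omega> \<in> sets borel"
    using assms by (auto simp: region_def)
  have v: "v \<in> L1_loc \<Omega>" and loc: "\<rho> \<in> L1_loc \<Omega>" "\<omega> \<in> L1_loc \<Omega>"
    using assms by (auto simp: has_weak_div_def has_weak_curl_def)
  obtain \<phi>0 G where \<phi>0: "\<phi>0 \<in> H1_0 \<Omega>" "has_weak_gradient \<Omega> \<phi>0 G"
    and G_int: "\<And>S. S \<in> sets borel \<Longrightarrow> bounded S \<Longrightarrow> set_integrable lebesgue S G"
    and G: "\<And>\<zeta>. \<zeta> \<in> C1_c \<Omega> \<Longrightarrow> (LINT x:\<Omega>|lebesgue. grad \<zeta> x \<bullet> G x) = (LINT x:\<Omega>|lebesgue. \<rho> x * \<zeta> x)"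
      "\<And>\<zeta>. \<zeta> \<in> C1_c \<Omega> \<Longrightarrow> (LINT x:\<Omega>|lebesgue. perp (grad \<zeta> x) \<bullet> G x) = 0"
    using weak_Poisson[OF \<Omega>(1,2) assms(4,6) loc(1)] by blast
  obtain \<psi>0 F where \<psi>0: "\<psi>0 \<in> H1_0 \<Omega>" "has_weak_gradient \<Omega> \<psi>0 F"
    and F_int: "\<And>S. S \<in> sets borel \<Longrightarrow> bounded S \<Longrightarrow> set_integrable lebesgue S F"
    and F: "\<And>\<zeta>. \<zeta> \<in> C1_c \<Omega> \<Longrightarrow> (LINT x:\<Omega>|lebesgue. grad \<zeta> x \<bullet> F x) = (LINT x:\<Omega>|lebesgue. \<omega> x * \<zeta> x)"
      "\<And>\<zeta>. \<zeta> \<in> C1_c \<Omega> \<Longrightarrow> (LINT x:\<Omega>|lebesgue. perp (grad \<zeta> x) \<bullet> F x) = 0"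
    using weak_Poisson[OF \<Omega>(1,2) assms(4,8) loc(2)] by blast
  \<comment> \<open>what remains of the field; testing it shows that the two potentials cancel its divergence and curl\<close>
  define h where "h x = v x - perp (F x) + G x" for x
  have perpF_int: "set_integrable lebesgue S (\<lambda>x. perp (F x))" if "S \<in> sets borel" "bounded S" for S
    using integrable_bounded_linear[OF linear_perp[unfolded linear_conv_bounded_linear]
        F_int[OF that, unfolded set_integrable_def]]
    by (simp add: set_integrable_def linear_cmul[OF linear_perp])
  have h_int: "set_integrable lebesgue S h"
    if "S \<in> sets borel" "bounded S" "set_integrable lebesgue S v" for S
    unfolding h_def[abs_def] using that G_int perpF_int
    by (intro set_integral_add(1) set_integral_diff(1))
  have loc_int: "f \<in> L1_loc \<Omega>" if "\<And>S. S \<in> sets borel \<Longrightarrow> bounded S \<Longrightarrow> set_integrable lebesgue S f"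
    for f :: "real^2 \<Rightarrow> real^2"
    using that by (auto simp: L1_loc_def borel_compact compact_imp_bounded)
  have h_loc: "h \<in> L1_loc \<Omega>"
    using v h_int by (auto simp: L1_loc_def borel_compact compact_imp_bounded)
  have h_test: "(LINT x:\<Omega>|lebesgue. w x \<bullet> h x)
      = (LINT x:\<Omega>|lebesgue. w x \<bullet> v x) + (LINT x:\<Omega>|lebesgue. perp (w x) \<bullet> F x) + (LINT x:\<Omega>|lebesgue. w x \<bullet> G x)"
    if w: "continuous_on UNIV w" "compact K" "K \<subseteq> \<Omega>" "\<And>x. x \<notin> K \<Longrightarrow> w x = 0" for w K
  proof -
    have "(LINT x:\<Omega>|lebesgue. w x \<bullet> h x)
        = (LINT x:\<Omega>|lebesgue. (w x \<bullet> v x + perp (w x) \<bullet> F x) + w x \<bullet> G x)"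
      by (simp add: h_def inner_add_right inner_diff_right perp_inner)
    also have "\<dots> = (LINT x:\<Omega>|lebesgue. w x \<bullet> v x + perp (w x) \<bullet> F x) + (LINT x:\<Omega>|lebesgue. w x \<bullet> G x)"
      using w v loc_int[OF F_int] loc_int[OF G_int]
      by (intro set_integral_add L1_loc_test_integrable[OF _ _ w(2,3)] continuous_intros) auto
    also have "(LINT x:\<Omega>|lebesgue. w x \<bullet> v x + perp (w x) \<bullet> F x)
        = (LINT x:\<Omega>|lebesgue. w x \<bullet> v x) + (LINT x:\<Omega>|lebesgue. perp (w x) \<bullet> F x)"
      using w v loc_int[OF F_int]
      by (intro set_integral_add L1_loc_test_integrable[OF _ _ w(2,3)] continuous_intros) auto
    finally show ?thesis .
  qed
  have harm: "harmonic_field \<Omega> h"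
    unfolding harmonic_field_def has_weak_div_def has_weak_curl_def
  proof (intro conjI ballI h_loc)
    show "(\<lambda>_. 0) \<in> L1_loc \<Omega>" "(\<lambda>_. 0) \<in> L1_loc \<Omega>"
      by (simp_all add: L1_loc_def set_integrable_def)
    fix \<zeta> assume \<zeta>: "\<zeta> \<in> C1_c \<Omega>"
    obtain K where K: "compact K" "K \<subseteq> \<Omega>" "\<forall>x. x \<notin> K \<longrightarrow> grad \<zeta> x = 0"
      using C1_cD(4)[OF \<zeta>] by blast
    have pp: "perp (perp a) = - a" for a
      by (simp add: perp_def vec_eq_iff forall_2)
    have "(LINT x:\<Omega>|lebesgue. grad \<zeta> x \<bullet> h x) = 0"
      using h_test[OF C1_cD(3)[OF \<zeta>] K(1,2)] K(3) F(2)[OF \<zeta>] G(1)[OF \<zeta>] assms(5) \<zeta>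
      by (simp add: has_weak_div_def)
    then show "(LINT x:\<Omega>|lebesgue. grad \<zeta> x \<bullet> h x) = - (LINT x:\<Omega>|lebesgue. 0 * \<zeta> x)"
      by (simp add: set_lebesgue_integral_def)
    have "(LINT x:\<Omega>|lebesgue. perp (grad \<zeta> x) \<bullet> h x) = 0"
      using h_test[OF continuous_on_perp[OF C1_cD(3)[OF \<zeta>]] K(1,2)] K(3) F(1)[OF \<zeta>] G(2)[OF \<zeta>] assms(7) \<zeta>
      by (simp add: has_weak_curl_def pp set_lebesgue_integral_def)
    then show "(LINT x:\<Omega>|lebesgue. perp (grad \<zeta> x) \<bullet> h x) = (LINT x:\<Omega>|lebesgue. 0 * \<zeta> x)"
      by (simp add: set_lebesgue_integral_def)
  qed
  have dec: "has_decomposition \<Omega> v \<psi>0 \<phi>0 h"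
    unfolding has_decomposition_def using \<phi>0 \<psi>0
    by (intro exI[of _ F] exI[of _ G]) (simp add: h_def)
  have "h \<in> L1 \<Omega>" if "v \<in> L1 \<Omega>"
    using that h_int \<Omega> by (simp add: L1_def)
  then show ?thesis
    using \<phi>0(1) \<psi>0(1) h_loc harm dec by blast
qed

end
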